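(* Let $w=(3,1)$ and let $f(x,y)$ be the germ at $0\in\mathbb{C}^2$ of a polynomial with an isolated singularity at $0$. If $\mathrm{fil}_w(f)\ge9$, then $f$ deforms to $J_{3,0}$.
   Context: For the weight $w=(3,1)$ on the variables $(x,y)$, $\mathrm{fil}_w(x^iy^j)=3i+j$, and $\mathrm{fil}_w(f)$ is the minimum of $\mathrm{fil}_w$ over the monomials appearing in the Taylor expansion of $f$ at $0$. $J_{3,0}$ is the family of germs $x^3+bx^2y^3+y^9+cxy^7$ with $b,c\in\mathbb{C}$, $4b^3+27\neq0$. Two germs are smoothly right equivalent if they differ by composition with a germ of biholomorphism of $(\mathbb{C}^2,0)$. A deformation of $f$ is an analytic map germ $F:(\mathbb{C}^2\times\mathbb{C}^l,0)\to(\mathbb{C},0)$, $F_t(x,y)=F(x,y,t)$, with $F_0=f$. The germ $f$ deforms to a family $\mathcal{D}$ if there is a deformation $F$ of $f$ such that for some arbitrarily small $t\ne0$ the germ of $F_t$ at $0$ is smoothly right equivalent to some germ in $\mathcal{D}$. *)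

theory Defs
  imports "HOL-Analysis.Analysis"
begin

text \<open>
  Germs at the origin are represented by functions; every notion below depends only on the
  values of these functions near the origin (for deformations: near the origin of
  \<open>\<complex>\<^sup>2 \<times> \<complex>\<^sup>l\<close>). A point of \<open>\<complex>\<^sup>2\<close> is a pair.
\<close>

definition polynomial2 :: "(complex \<times> complex \<Rightarrow> complex) \<Rightarrow> bool" where
  "polynomial2 f \<longleftrightarrow>
     (\<exists>(N::nat) a. \<forall>x y. f (x, y) = (\<Sum>i\<le>N. \<Sum>j\<le>N. a i j * x ^ i * y ^ j))"

definition taylor_coeff :: "(complex \<times> complex \<Rightarrow> complex) \<Rightarrow> nat \<Rightarrow> nat \<Rightarrow> complex" where
  "taylor_coeff f i j =
     (deriv ^^ i) (\<lambda>x. (deriv ^^ j) (\<lambda>y. f (x, y)) 0) 0 / (fact i * fact j)"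

text \<open>The filtration of the zero germ is \<open>\<infinity>\<close>, the infimum of the empty set in \<^typ>\<open>enat\<close>.\<close>

definition fil :: "nat \<times> nat \<Rightarrow> (complex \<times> complex \<Rightarrow> complex) \<Rightarrow> enat" where
  "fil w f = (INF (i, j) \<in> {(i, j). taylor_coeff f i j \<noteq> 0}. enat (fst w * i + snd w * j))"

definition critical_point :: "(complex \<times> complex \<Rightarrow> complex) \<Rightarrow> complex \<times> complex \<Rightarrow> bool" where
  "critical_point f p \<longleftrightarrow> (f has_derivative (\<lambda>_. 0)) (at p)"

text \<open>The filter \<open>at 0\<close> is that of punctured neighbourhoods.\<close>

definition isolated_singularity :: "(complex \<times> complex \<Rightarrow> complex) \<Rightarrow> bool" where
  "isolated_singularity f \<longleftrightarrow>
     critical_point f 0 \<and> (\<forall>\<^sub>F p in at 0. \<not> critical_point f p)"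

text \<open>Holomorphic maps: the real derivative exists and is given by a complex matrix.\<close>

definition holomorphic_map_on ::
    "(complex \<times> complex \<Rightarrow> complex \<times> complex) \<Rightarrow> (complex \<times> complex) set \<Rightarrow> bool" where
  "holomorphic_map_on \<phi> U \<longleftrightarrow>
     (\<forall>p\<in>U. \<exists>a b c d. (\<phi> has_derivative (\<lambda>(u, v). (a * u + b * v, c * u + d * v))) (at p))"

definition biholomorphism_germ :: "(complex \<times> complex \<Rightarrow> complex \<times> complex) \<Rightarrow> bool" where
  "biholomorphism_germ \<phi> \<longleftrightarrow> \<phi> 0 = 0 \<and>
     (\<exists>U V \<psi>. open U \<and> open V \<and> 0 \<in> U \<and> homeomorphism U V \<phi> \<psi> \<and>
        holomorphic_map_on \<phi> U \<and> holomorphic_map_on \<psi> V)"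

definition right_equivalent ::
    "(complex \<times> complex \<Rightarrow> complex) \<Rightarrow> (complex \<times> complex \<Rightarrow> complex) \<Rightarrow> bool" where
  "right_equivalent f g \<longleftrightarrow>
     (\<exists>\<phi>. biholomorphism_germ \<phi> \<and> (\<forall>\<^sub>F p in nhds 0. f p = g (\<phi> p)))"

text \<open>
  Since the number of parameters of a deformation is existentially quantified, \<open>\<complex>\<^sup>n\<close> (and the set
  \<open>\<nat>\<^sup>n\<close> of multi-indices) is represented by the sequences vanishing from index \<open>n\<close> on.
\<close>

definition tuples :: "nat \<Rightarrow> (nat \<Rightarrow> 'a::zero) set" where
  "tuples n = {z. \<forall>i\<ge>n. z i = 0}"

text \<open>\<open>F\<close> is the sum of a power series in \<open>n\<close> variables on some polydisc around the origin.\<close>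

definition analytic_germ :: "nat \<Rightarrow> ((nat \<Rightarrow> complex) \<Rightarrow> complex) \<Rightarrow> bool" where
  "analytic_germ n F \<longleftrightarrow>
     (\<exists>a r. r > 0 \<and> (\<forall>z\<in>tuples n. (\<forall>i<n. cmod (z i) < r) \<longrightarrow>
        ((\<lambda>\<alpha>. a \<alpha> * (\<Prod>i<n. z i ^ \<alpha> i)) has_sum F z) (tuples n :: (nat \<Rightarrow> nat) set)))"

text \<open>The coordinates \<open>0, 1\<close> of \<open>z\<close> below are \<open>x, y\<close>; the remaining \<open>l\<close> ones are the parameters.\<close>

definition deformation ::
    "nat \<Rightarrow> (complex \<times> complex \<Rightarrow> complex) \<Rightarrow>
     (complex \<times> complex \<Rightarrow> (nat \<Rightarrow> complex) \<Rightarrow> complex) \<Rightarrow> bool" where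
  "deformation l f F \<longleftrightarrow>
     analytic_germ (2 + l) (\<lambda>z. F (z 0, z 1) (\<lambda>i. z (2 + i))) \<and>
     F 0 (\<lambda>_. 0) = 0 \<and>
     (\<forall>\<^sub>F p in nhds 0. F p (\<lambda>_. 0) = f p)"

definition deforms_to ::
    "(complex \<times> complex \<Rightarrow> complex) \<Rightarrow> (complex \<times> complex \<Rightarrow> complex) set \<Rightarrow> bool" where
  "deforms_to f D \<longleftrightarrow>
     (\<exists>l F. deformation l f F \<and>
        (\<forall>\<epsilon>>0. \<exists>t\<in>tuples l. t \<noteq> (\<lambda>_. 0) \<and> (\<forall>i<l. cmod (t i) < \<epsilon>) \<and>
           (\<exists>g\<in>D. right_equivalent (\<lambda>p. F p t) g)))"

definition J30 :: "(complex \<times> complex \<Rightarrow> complex) set" where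
  "J30 = {(\<lambda>(x, y). x ^ 3 + b * x ^ 2 * y ^ 3 + y ^ 9 + c * x * y ^ 7) | b c.
            4 * b ^ 3 + 27 \<noteq> 0}"

end

theory Submission imports Defs begin

text \<open>
  The terms of weight 9 of \<open>f\<close> form a binary cubic in \<open>x\<close> and \<open>y\<^sup>3\<close>; adding small generic multiples of
  \<open>x\<^sup>3\<close> and \<open>y\<^sup>9\<close> makes it nondegenerate. A polynomial change of coordinates then turns the germ into
  \<open>g + h\<close>, where \<open>g = x\<^sup>3 + b x\<^sup>2 y\<^sup>3 + y\<^sup>9 + c x y\<^sup>7\<close> and all monomials of \<open>h\<close> have weight at least 11.
  To remove \<open>h\<close>, look for a displacement \<open>(u, m)\<close> of \<open>(x, y)\<close> depending linearly on five unknown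
  functions \<open>w\<^sub>k\<close> of \<open>x, y\<close> such that \<open>g (x + u, y + m) = g + h\<close>. Both \<open>h\<close> and
  \<open>g (x + u, y + m) - g\<close> lie in the ideal of five monomials \<open>G\<^sub>k\<close>, and the displacement can be chosen so
  that the coefficient of \<open>G\<^sub>k\<close> in the latter is \<open>w\<^sub>k\<close> plus terms which vanish at \<open>x = y = 0\<close>
  whatever \<open>w\<close> is, because all quadratic terms have higher weight. Comparing coefficients of the
  \<open>G\<^sub>k\<close> gives five equations, which the inverse function theorem solves for \<open>w\<close>.
\<close>

section \<open>Weights\<close>

text \<open>
  Allowing arbitrary functions \<open>x\<close> and \<open>y\<close> turns the substitution of new coordinates into a
  transitivity property (\<open>wt_subst\<close>).
\<close>

inductive wt ::
    "('a \<Rightarrow> complex) set \<Rightarrow> ('a \<Rightarrow> complex) \<Rightarrow> ('a \<Rightarrow> complex) \<Rightarrow> nat \<Rightarrow> ('a \<Rightarrow> complex) \<Rightarrow> bool"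
  for R x y d where
  wt_monomial: "c \<in> R \<Longrightarrow> d \<le> 3 * i + j \<Longrightarrow> wt R x y d (\<lambda>p. c p * x p ^ i * y p ^ j)"
| wt_add: "wt R x y d f \<Longrightarrow> wt R x y d g \<Longrightarrow> wt R x y d (\<lambda>p. f p + g p)"

text \<open>Sums of functions come from \<open>wt_add\<close>, so coefficients are only ever
  multiplied. The instances are \<open>constants\<close>, for given functions, and
  \<open>polyfun\<close>, for terms involving the unknowns.\<close>

definition coeff_monoid :: "('a \<Rightarrow> complex) set \<Rightarrow> bool" where
  "coeff_monoid R \<longleftrightarrow>
     range (\<lambda>c _. c) \<subseteq> R \<and> (\<forall>a\<in>R. \<forall>b\<in>R. (\<lambda>p. a p * b p) \<in> R)"

abbreviation constants :: "('a \<Rightarrow> complex) set" where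
  "constants \<equiv> range (\<lambda>c _. c)"

lemma coeff_monoid_constants: "coeff_monoid constants"
  by (auto simp: coeff_monoid_def)

lemma wt_mono: "wt R x y e f \<Longrightarrow> d \<le> e \<Longrightarrow> wt R x y d f"
  by (induction rule: wt.induct) (auto intro: wt.intros)

lemma wt_coeff:
  assumes "wt R x y d f" "coeff_monoid R" "c \<in> R"
  shows "wt R x y d (\<lambda>p. c p * f p)"
  using assms(1)
proof induction
  case (wt_monomial a i j)
  have "wt R x y d (\<lambda>p. (c p * a p) * x p ^ i * y p ^ j)"
    using wt_monomial assms(2,3) by (intro wt.wt_monomial) (auto simp: coeff_monoid_def)
  then show ?case by (simp add: mult.assoc)
next
  case (wt_add f g)
  from wt.wt_add[OF wt_add.IH] show ?case by (simp add: distrib_left)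
qed

lemma wt_const:
  assumes "coeff_monoid R"
  shows "wt R x y 0 (\<lambda>p. c)"
  using wt_monomial[of "\<lambda>_. c" R 0 0 0 x y] assms by (auto simp: coeff_monoid_def)

lemma wt_coeff_self:
  assumes "coeff_monoid R" "c \<in> R"
  shows "wt R x y 0 c"
  using wt_coeff[OF wt_const[OF assms(1), of _ _ 1] assms] by simp

lemma wt_zero:
  assumes "coeff_monoid R"
  shows "wt R x y d (\<lambda>p. 0)"
  using wt_monomial[of "\<lambda>_. 0" R d d 0 x y] assms by (auto simp: coeff_monoid_def)

lemma wt_x:
  assumes "coeff_monoid R"
  shows "wt R x y 3 x"
  using wt_monomial[of "\<lambda>_. 1" R 3 1 0 x y] assms by (auto simp: coeff_monoid_def)

lemma wt_y:
  assumes "coeff_monoid R"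
  shows "wt R x y 1 y"
  using wt_monomial[of "\<lambda>_. 1" R 1 0 1 x y] assms by (auto simp: coeff_monoid_def)

lemma wt_mult:
  assumes "coeff_monoid R" "wt R x y d f" "wt R x y e g" "n \<le> d + e"
  shows "wt R x y n (\<lambda>p. f p * g p)"
proof -
  have "wt R x y (d + e) (\<lambda>p. f p * g p)"
    using assms(2)
  proof induction
    case (wt_monomial a i j)
    have "wt R x y (d + e) (\<lambda>p. x p ^ i * y p ^ j * g p)"
      using assms(3)
    proof induction
      case (wt_monomial b k l)
      have "wt R x y (d + e) (\<lambda>p. b p * x p ^ (i + k) * y p ^ (j + l))"
        using wt_monomial \<open>d \<le> 3 * i + j\<close> by (intro wt.wt_monomial) auto
      then show ?case by (simp add: power_add mult_ac)
    next
      case (wt_add f g)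
      from wt.wt_add[OF wt_add.IH] show ?case by (simp add: distrib_left)
    qed
    from wt_coeff[OF this assms(1) \<open>a \<in> R\<close>] show ?case by (simp add: mult.assoc)
  next
    case (wt_add f g)
    from wt.wt_add[OF wt_add.IH] show ?case by (simp add: distrib_right)
  qed
  then show ?thesis using wt_mono assms(4) by blast
qed

lemma wt_power:
  assumes "coeff_monoid R" "wt R x y d f" "m \<le> n * d"
  shows "wt R x y m (\<lambda>p. f p ^ n)"
proof -
  have "wt R x y (n * d) (\<lambda>p. f p ^ n)"
  proof (induction n)
    case 0
    then show ?case using wt_const[OF assms(1)] by simp
  next
    case (Suc n)
    then show ?case using wt_mult[OF assms(1,2) Suc] by simp
  qed
  then show ?thesis using wt_mono assms(3) by blast
qed

text \<open>With exact weights in the conclusion, resolution computes the weight of a product, and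
  \<open>wt_mono\<close> leaves a single numerical inequality. \<open>wt_power_times\<close> does
  the same for powers.\<close>

lemma wt_mult_plus:
  assumes "coeff_monoid R" "wt R x y d f" "wt R x y e g"
  shows "wt R x y (d + e) (\<lambda>p. f p * g p)"
  using wt_mult[OF assms] by simp

lemma wt_power_times:
  assumes "coeff_monoid R" "wt R x y d f"
  shows "wt R x y (n * d) (\<lambda>p. f p ^ n)"
  using wt_power[OF assms] by simp

lemma wt_sum:
  assumes "coeff_monoid R" "finite S" "\<And>s. s \<in> S \<Longrightarrow> wt R x y d (f s)"
  shows "wt R x y d (\<lambda>p. \<Sum>s\<in>S. f s p)"
  using assms(2,3)
  by (induction S rule: finite_induct) (auto intro: wt_zero[OF assms(1)] wt_add)

lemma wt_subst:
  assumes "coeff_monoid R" "wt R X Y d f" "wt R x y 3 X" "wt R x y 1 Y"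
  shows "wt R x y d f"
  using assms(2)
proof induction
  case (wt_monomial c i j)
  have "wt R x y (3 * i) (\<lambda>p. X p ^ i)" "wt R x y j (\<lambda>p. Y p ^ j)"
    by (auto intro: wt_power[OF assms(1)] assms(3,4))
  then have "wt R x y d (\<lambda>p. X p ^ i * Y p ^ j)"
    by (rule wt_mult[OF assms(1)]) (use wt_monomial in auto)
  from wt_coeff[OF this assms(1) \<open>c \<in> R\<close>] show ?case by (simp add: mult.assoc)
qed (rule wt_add)

text \<open>Constants survive composition with \<open>h\<close>, so only the coordinate functions
  change. Followed by \<open>wt_subst\<close>, this handles a substitution of new
  coordinates.\<close>

lemma wt_constants_comp:
  assumes "wt constants x y d f"
  shows "wt constants (\<lambda>p. x (h p)) (\<lambda>p. y (h p)) d (\<lambda>p. f (h p))"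
  using assms
proof induction
  case (wt_monomial c i j)
  then show ?case
    using wt.wt_monomial[of "\<lambda>p. c (h p)" constants d i j "\<lambda>p. x (h p)" "\<lambda>p. y (h p)"] by auto
qed (rule wt_add)

text \<open>A monomial of weight at least \<open>d\<close> either has weight exactly
  \<open>d\<close>, hence is \<open>x ^ i * y ^ (d - 3 * i)\<close> with
  \<open>i \<le> d div 3\<close>, or has weight at least \<open>Suc d\<close> and goes into
  \<open>g\<close>.\<close>

lemma wt_leading_part:
  assumes "wt constants x y d f"
  obtains a g where "wt constants x y (Suc d) g"
    "\<And>p. f p = (\<Sum>i\<le>d div 3. a i * x p ^ i * y p ^ (d - 3 * i)) + g p"
proof -
  from assms have "\<exists>a g. wt constants x y (Suc d) g \<and>
    (\<forall>p. f p = (\<Sum>i\<le>d div 3. a i * x p ^ i * y p ^ (d - 3 * i)) + g p)"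
  proof induction
    case (wt_monomial c i j)
    then obtain c0 where c: "c = (\<lambda>_. c0)" by auto
    show ?case
    proof (cases "d = 3 * i + j")
      case True
      then have i: "i \<le> d div 3" and j: "j = d - 3 * i" by auto
      have "(\<Sum>k\<le>d div 3. (if k = i then c0 else 0) * x p ^ k * y p ^ (d - 3 * k))
          = (\<Sum>k\<le>d div 3. if k = i then c0 * x p ^ i * y p ^ (d - 3 * i) else 0)" for p
        by (intro sum.cong) auto
      also have "\<dots> p = c0 * x p ^ i * y p ^ j" for p
        using i j by simp
      finally have eq: "(\<Sum>k\<le>d div 3. (if k = i then c0 else 0) * x p ^ k * y p ^ (d - 3 * k))
          = c0 * x p ^ i * y p ^ j" for p .
      show ?thesis
        by (rule exI[of _ "\<lambda>k. if k = i then c0 else 0"], rule exI[of _ "\<lambda>_. 0"])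
          (simp only: eq c, simp add: wt_zero[OF coeff_monoid_constants])
    next
      case False
      then have "wt constants x y (Suc d) (\<lambda>p. c p * x p ^ i * y p ^ j)"
        using wt_monomial by (intro wt.wt_monomial) auto
      then show ?thesis
        by (intro exI[of _ "\<lambda>_. 0"] exI[of _ "\<lambda>p. c p * x p ^ i * y p ^ j"]) auto
    qed
  next
    case (wt_add f g)
    then obtain a f' b g' where "wt constants x y (Suc d) f'" "wt constants x y (Suc d) g'"
      "\<forall>p. f p = (\<Sum>i\<le>d div 3. a i * x p ^ i * y p ^ (d - 3 * i)) + f' p"
      "\<forall>p. g p = (\<Sum>i\<le>d div 3. b i * x p ^ i * y p ^ (d - 3 * i)) + g' p"
      by blast
    then show ?case
      by (intro exI[of _ "\<lambda>i. a i + b i"] exI[of _ "\<lambda>p. f' p + g' p"])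
        (auto intro: wt.wt_add simp: sum.distrib distrib_right)
  qed
  then show ?thesis using that by blast
qed

section \<open>Biholomorphisms from polynomial equations\<close>

text \<open>
  A point is \<open>((x, y), w)\<close>: the two variables together with the five unknowns of the system of
  equations solved by the inverse function theorem.
\<close>

datatype idx = I0 | I1 | I2 | I3 | I4

lemma UNIV_idx: "UNIV = {I0, I1, I2, I3, I4}"
  using idx.exhaust by auto

instance idx :: finite
  by standard (simp add: UNIV_idx)

type_synonym pt = "(complex \<times> complex) \<times> (complex ^ idx)"

abbreviation xc :: "pt \<Rightarrow> complex" where "xc p \<equiv> fst (fst p)"
abbreviation yc :: "pt \<Rightarrow> complex" where "yc p \<equiv> snd (fst p)"
abbreviation wc :: "idx \<Rightarrow> pt \<Rightarrow> complex" where "wc k p \<equiv> snd p $ k"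

inductive_set polyfun :: "(pt \<Rightarrow> complex) set" where
  const [intro]: "(\<lambda>_. c) \<in> polyfun"
| x [intro]: "xc \<in> polyfun"
| y [intro]: "yc \<in> polyfun"
| w [intro]: "wc k \<in> polyfun"
| add [intro]: "a \<in> polyfun \<Longrightarrow> b \<in> polyfun \<Longrightarrow> (\<lambda>p. a p + b p) \<in> polyfun"
| mult [intro]: "a \<in> polyfun \<Longrightarrow> b \<in> polyfun \<Longrightarrow> (\<lambda>p. a p * b p) \<in> polyfun"

lemma polyfun_diff [intro]:
  assumes "a \<in> polyfun" "b \<in> polyfun"
  shows "(\<lambda>p. a p - b p) \<in> polyfun"
  using polyfun.add[OF assms(1) polyfun.mult[OF polyfun.const[of "-1"] assms(2)]] by simp

lemma polyfun_power [intro]: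
  assumes "a \<in> polyfun"
  shows "(\<lambda>p. a p ^ n) \<in> polyfun"
  using assms by (induction n) auto

text \<open>Multiplication by \<i>. A real-linear map is complex linear exactly when it commutes
  with it; this carries holomorphy through real derivatives.\<close>

definition imul :: "pt \<Rightarrow> pt" where
  "imul p = ((\<i> * xc p, \<i> * yc p), \<chi> k. \<i> * wc k p)"

text \<open>Induction over the closure rules. In finite dimension, continuity of
  \<open>D p v\<close> in \<open>p\<close> for each \<open>v\<close> gives the continuous derivative
  that the inverse function theorem asks for.\<close>

lemma polyfun_derivative:
  assumes "a \<in> polyfun"
  shows "\<exists>D. \<forall>p. (a has_derivative D p) (at p) \<and> (\<forall>v. continuous_on UNIV (\<lambda>p. D p v)) \<and>
    (\<forall>v. D p (imul v) = \<i> * D p v)"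
  using assms
proof induction
  case (const c)
  show ?case by (rule exI[of _ "\<lambda>_ _. 0"]) auto
next
  case x
  have "bounded_linear xc"
    by (intro bounded_linear_compose[OF bounded_linear_fst bounded_linear_fst])
  then show ?case
    by (intro exI[of _ "\<lambda>_. xc"]) (auto simp: imul_def bounded_linear_imp_has_derivative)
next
  case y
  have "bounded_linear yc"
    by (intro bounded_linear_compose[OF bounded_linear_snd bounded_linear_fst])
  then show ?case
    by (intro exI[of _ "\<lambda>_. yc"]) (auto simp: imul_def bounded_linear_imp_has_derivative)
next
  case (w k)
  have "bounded_linear (wc k)"
    by (intro bounded_linear_compose[OF bounded_linear_vec_nth bounded_linear_snd])
  then show ?case
    by (intro exI[of _ "\<lambda>_. wc k"]) (auto simp: imul_def bounded_linear_imp_has_derivative)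
next
  case (add a b)
  then obtain A B where
    "\<And>p. (a has_derivative A p) (at p)" "\<And>v. continuous_on UNIV (\<lambda>p. A p v)"
    "\<And>p v. A p (imul v) = \<i> * A p v"
    "\<And>p. (b has_derivative B p) (at p)" "\<And>v. continuous_on UNIV (\<lambda>p. B p v)"
    "\<And>p v. B p (imul v) = \<i> * B p v"
    by metis
  then show ?case
    by (intro exI[of _ "\<lambda>p v. A p v + B p v"] allI conjI has_derivative_add continuous_intros)
      (simp_all add: distrib_left)
next
  case (mult a b)
  then obtain A B where
    D: "\<And>p. (a has_derivative A p) (at p)" "\<And>v. continuous_on UNIV (\<lambda>p. A p v)"
    "\<And>p v. A p (imul v) = \<i> * A p v"
    "\<And>p. (b has_derivative B p) (at p)" "\<And>v. continuous_on UNIV (\<lambda>p. B p v)"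
    "\<And>p v. B p (imul v) = \<i> * B p v"
    by metis
  have c: "continuous_on UNIV a" "continuous_on UNIV b"
    using D(1,4) has_derivative_continuous
    by (auto simp: continuous_on_eq_continuous_at) blast+
  show ?case
  proof (intro exI[of _ "\<lambda>p v. a p * B p v + A p v * b p"] allI conjI)
    show "((\<lambda>p. a p * b p) has_derivative (\<lambda>v. a p * B p v + A p v * b p)) (at p)" for p
      by (rule has_derivative_mult[OF D(1,4)])
  qed (auto intro!: D continuous_intros c simp: D algebra_simps)
qed

lemma polyfun_pair_derivative:
  fixes \<phi> :: "pt \<Rightarrow> complex \<times> complex"
  assumes "(\<lambda>p. fst (\<phi> p)) \<in> polyfun" "(\<lambda>p. snd (\<phi> p)) \<in> polyfun"
  obtains D where "\<And>p. (\<phi> has_derivative D p) (at p)"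
    "\<And>v. continuous_on UNIV (\<lambda>p. D p v)"
    "\<And>p v. D p (imul v) = (\<i> * fst (D p v), \<i> * snd (D p v))"
proof -
  obtain A B where
    D: "\<And>p. ((\<lambda>p. fst (\<phi> p)) has_derivative A p) (at p)" "\<And>v. continuous_on UNIV (\<lambda>p. A p v)"
    "\<And>p v. A p (imul v) = \<i> * A p v"
    "\<And>p. ((\<lambda>p. snd (\<phi> p)) has_derivative B p) (at p)" "\<And>v. continuous_on UNIV (\<lambda>p. B p v)"
    "\<And>p v. B p (imul v) = \<i> * B p v"
    using assms[THEN polyfun_derivative] by metis
  show ?thesis
  proof
    show "(\<phi> has_derivative (\<lambda>v. (A p v, B p v))) (at p)" for p
      using has_derivative_Pair[OF D(1)[of p] D(4)[of p]] by simp
  qed (auto simp: D intro!: continuous_intros)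
qed

lemma has_derivative_vecI:
  fixes f :: "'a :: euclidean_space \<Rightarrow> 'b :: euclidean_space ^ 'n"
  assumes "\<And>k. ((\<lambda>x. f x $ k) has_derivative (\<lambda>v. f' v $ k)) (at x)"
  shows "(f has_derivative f') (at x)"
  unfolding has_derivative_componentwise_within[of f]
proof
  fix i :: "'b ^ 'n" assume "i \<in> Basis"
  then obtain k b where "i = axis k b" by (auto simp: Basis_vec_def)
  with has_derivative_inner_left[OF assms[of k], of b]
  show "((\<lambda>x. f x \<bullet> i) has_derivative (\<lambda>x. f' x \<bullet> i)) (at x)"
    by (simp add: inner_axis)
qed

text \<open>Quantifying over derivatives avoids naming the derivative, which is unique. As source
  and target have equal dimension, injectivity amounts to invertibility.\<close>

definition injective_derivative :: "(pt \<Rightarrow> pt) \<Rightarrow> pt \<Rightarrow> bool" where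
  "injective_derivative Q p \<longleftrightarrow>
     (\<forall>Q' v. (Q has_derivative Q') (at p) \<longrightarrow> Q' v = 0 \<longrightarrow> v = 0)"

text \<open>The inverse of a linear map commuting with \<open>imul\<close> commutes with
  \<open>imul\<close>, so the real inverse function theorem yields a holomorphic local
  inverse.\<close>

lemma polyfun_local_inverse:
  fixes \<phi> :: "pt \<Rightarrow> complex \<times> complex" and E :: "pt \<Rightarrow> complex ^ idx"
  assumes \<phi>: "(\<lambda>p. fst (\<phi> p)) \<in> polyfun" "(\<lambda>p. snd (\<phi> p)) \<in> polyfun"
    and E: "\<And>k. (\<lambda>p. E p $ k) \<in> polyfun"
    and inj: "injective_derivative (\<lambda>p. (\<phi> p, E p)) p0"
  obtains U V R where "open U" "open V" "p0 \<in> U" "homeomorphism U V (\<lambda>p. (\<phi> p, E p)) R"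
    "\<And>q. q \<in> V \<Longrightarrow> \<exists>R'. (R has_derivative R') (at q) \<and> (\<forall>v. R' (imul v) = imul (R' v))"
proof -
  let ?Q = "\<lambda>p. (\<phi> p, E p)"
  obtain D where D: "\<And>p. (\<phi> has_derivative D p) (at p)"
    "\<And>v. continuous_on UNIV (\<lambda>p. D p v)"
    "\<And>p v. D p (imul v) = (\<i> * fst (D p v), \<i> * snd (D p v))"
    by (rule polyfun_pair_derivative[OF \<phi>]) (rule that)
  have "\<forall>k. \<exists>C. \<forall>p. ((\<lambda>p. E p $ k) has_derivative C p) (at p) \<and>
      (\<forall>v. continuous_on UNIV (\<lambda>p. C p v)) \<and> (\<forall>v. C p (imul v) = \<i> * C p v)"
    using polyfun_derivative[OF E] by blast
  then obtain C where C: "\<And>k p. ((\<lambda>p. E p $ k) has_derivative C k p) (at p)"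
    "\<And>k v. continuous_on UNIV (\<lambda>p. C k p v)"
    "\<And>k p v. C k p (imul v) = \<i> * C k p v"
    by metis
  define Q' where "Q' = (\<lambda>p v. (D p v, \<chi> k. C k p v))"
  have "(E has_derivative (\<lambda>v. \<chi> k. C k p v)) (at p)" for p
    by (rule has_derivative_vecI) (simp add: C(1))
  then have Q': "(?Q has_derivative Q' p) (at p)" for p
    unfolding Q'_def by (intro has_derivative_Pair D(1))
  have bl: "bounded_linear (Q' p)" for p
    using Q' has_derivative_bounded_linear by blast
  have cont: "continuous_on UNIV (\<lambda>p. Blinfun (Q' p))"
  proof (rule continuous_on_blinfun_componentwise)
    show "continuous_on UNIV (\<lambda>p. blinfun_apply (Blinfun (Q' p)) i)" for i
      unfolding bounded_linear_Blinfun_apply[OF bl]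
      unfolding Q'_def
      by (intro continuous_intros D C)
  qed
  have imul: "Q' p (imul v) = imul (Q' p v)" for p v
    by (simp add: Q'_def D(3) C(3)) (simp add: imul_def)
  have "inj (Q' p0)"
    using inj Q' linear_injective_0 bl bounded_linear.linear unfolding injective_derivative_def by blast
  then obtain g where g: "linear g" "g \<circ> Q' p0 = id"
    using linear_injective_left_inverse bl bounded_linear.linear by metis
  then have "bounded_linear g" by (simp add: linear_conv_bounded_linear)
  then have inv: "Blinfun g o\<^sub>L Blinfun (Q' p0) = id_blinfun"
    using g(2) by (intro blinfun_eqI) (auto simp: bounded_linear_Blinfun_apply bl fun_eq_iff)
  have dQ: "(?Q has_derivative blinfun_apply (Blinfun (Q' p))) (at p)" for p
    by (simp add: bounded_linear_Blinfun_apply bl Q')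
  obtain U V R R' where R: "open U" "open V" "p0 \<in> U" "homeomorphism U V ?Q R"
    "\<And>q. q \<in> V \<Longrightarrow> (R has_derivative R' q) (at q)"
    "\<And>q. q \<in> V \<Longrightarrow> R' q = inv (blinfun_apply (Blinfun (Q' (R q))))"
    "\<And>q. q \<in> V \<Longrightarrow> bij (blinfun_apply (Blinfun (Q' (R q))))"
    by (rule inverse_function_theorem[OF open_UNIV dQ cont UNIV_I inv]) (rule that)
  show ?thesis
  proof
    fix q assume q: "q \<in> V"
    have "R' q (imul v) = imul (R' q v)" for v
    proof -
      have b: "bij (Q' (R q))" "R' q = inv (Q' (R q))"
        using R(6,7)[OF q] by (simp_all add: bounded_linear_Blinfun_apply bl)
      have "Q' (R q) (imul (R' q v)) = imul v"
        using b by (simp add: imul bij_is_surj surj_f_inv_f)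
      then show ?thesis using b by (metis bij_inv_eq_iff)
    qed
    then show "\<exists>R'. (R has_derivative R') (at q) \<and> (\<forall>v. R' (imul v) = imul (R' v))"
      using R(5)[OF q] by blast
  qed (use R in auto)
qed

lemma complex_linear_matrix:
  fixes A :: "complex \<times> complex \<Rightarrow> complex \<times> complex"
  assumes "linear A" "\<And>u v. A (\<i> * u, \<i> * v) = (\<i> * fst (A (u, v)), \<i> * snd (A (u, v)))"
  shows "\<exists>a b c d. A = (\<lambda>(u, v). (a * u + b * v, c * u + d * v))"
proof -
  interpret linear A by fact
  define a b c d where "a = fst (A (1, 0))" "b = fst (A (0, 1))" "c = snd (A (1, 0))" "d = snd (A (0, 1))"
  note A = this
  have "A (u, v) = (a * u + b * v, c * u + d * v)" for u v
  proof -
    \<comment> \<open>\<open>(\<i>, 0)\<close> and \<open>(0, \<i>)\<close> are written as multiples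
      by \<i> so that \<open>assms(2)\<close> reduces \<open>A\<close> there to its values at
      \<open>(1, 0)\<close> and \<open>(0, 1)\<close>.\<close>
    have "(u, v) = Re u *\<^sub>R (1, 0) + Im u *\<^sub>R (\<i> * 1, \<i> * 0) + Re v *\<^sub>R (0, 1) + Im v *\<^sub>R (\<i> * 0, \<i> * 1)"
      by (simp add: complex_eq_iff)
    then have "A (u, v) = Re u *\<^sub>R A (1, 0) + Im u *\<^sub>R A (\<i> * 1, \<i> * 0)
        + Re v *\<^sub>R A (0, 1) + Im v *\<^sub>R A (\<i> * 0, \<i> * 1)"
      by (simp only: add scale)
    then show ?thesis
      unfolding assms(2)
      by (subst (1 2) complex_eq[of u], subst (1 2) complex_eq[of v])
        (simp add: A prod_eq_iff scaleR_conv_of_real algebra_simps)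
  qed
  then show ?thesis
    by (intro exI[of _ a] exI[of _ b] exI[of _ c] exI[of _ d]) auto
qed

text \<open>Chain rule for three maps whose derivatives commute with \<i>. In use, \<open>R\<close>
  inverts a chart paired with \<open>E\<close>, so the slice parametrizes
  \<open>E = 0\<close>.\<close>

lemma holomorphic_map_on_slice:
  fixes \<phi> :: "pt \<Rightarrow> complex \<times> complex" and R :: "pt \<Rightarrow> pt"
  assumes \<phi>: "(\<lambda>p. fst (\<phi> p)) \<in> polyfun" "(\<lambda>p. snd (\<phi> p)) \<in> polyfun"
    and R: "\<And>z. z \<in> U \<Longrightarrow> \<exists>R'. (R has_derivative R') (at (z, 0)) \<and> (\<forall>v. R' (imul v) = imul (R' v))"
  shows "holomorphic_map_on (\<lambda>z. \<phi> (R (z, 0))) U"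
  unfolding holomorphic_map_on_def
proof
  fix z assume "z \<in> U"
  then obtain R' where R': "(R has_derivative R') (at (z, 0))" "\<And>v. R' (imul v) = imul (R' v)"
    using R by blast
  obtain D where D: "\<And>p. (\<phi> has_derivative D p) (at p)" "\<And>v. continuous_on UNIV (\<lambda>p. D p v)"
    "\<And>p v. D p (imul v) = (\<i> * fst (D p v), \<i> * snd (D p v))"
    by (rule polyfun_pair_derivative[OF \<phi>]) (rule that)
  have "((\<lambda>z. (z, 0 :: complex ^ idx)) has_derivative (\<lambda>v. (v, 0))) (at z)"
    by (auto intro!: derivative_eq_intros)
  from has_derivative_compose[OF this R'(1)] have
    "((\<lambda>z. R (z, 0)) has_derivative (\<lambda>v. R' (v, 0))) (at z)" .
  from has_derivative_compose[OF this D(1)] have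
    d: "((\<lambda>z. \<phi> (R (z, 0))) has_derivative (\<lambda>v. D (R (z, 0)) (R' (v, 0)))) (at z)" .
  have "((\<i> * u, \<i> * v), 0) = imul ((u, v), 0)" for u v
    by (simp add: imul_def vec_eq_iff)
  then have "\<exists>a b c d. (\<lambda>v. D (R (z, 0)) (R' (v, 0))) = (\<lambda>(u, v). (a * u + b * v, c * u + d * v))"
    using d by (intro complex_linear_matrix) (auto simp: D R' has_derivative_linear)
  then obtain a b c e where
    eq: "(\<lambda>v. D (R (z, 0)) (R' (v, 0))) = (\<lambda>(u, v). (a * u + b * v, c * u + e * v))"
    by blast
  then show "\<exists>a b c d. ((\<lambda>z. \<phi> (R (z, 0))) has_derivative (\<lambda>(u, v). (a * u + b * v, c * u + d * v))) (at z)"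
    using d unfolding eq by (intro exI)
qed

text \<open>
  Near \<open>p0\<close> the zero set of \<open>E\<close> is a surface on which both \<open>\<phi>\<close> and \<open>\<phi>'\<close> are coordinates; \<open>\<psi>\<close> is the
  change of coordinates.
\<close>

lemma biholomorphism_germ_between_charts:
  fixes \<phi> \<phi>' :: "pt \<Rightarrow> complex \<times> complex" and E :: "pt \<Rightarrow> complex ^ idx"
  assumes \<phi>: "(\<lambda>p. fst (\<phi> p)) \<in> polyfun" "(\<lambda>p. snd (\<phi> p)) \<in> polyfun"
    and \<phi>': "(\<lambda>p. fst (\<phi>' p)) \<in> polyfun" "(\<lambda>p. snd (\<phi>' p)) \<in> polyfun"
    and E: "\<And>k. (\<lambda>p. E p $ k) \<in> polyfun"
    and inj: "injective_derivative (\<lambda>p. (\<phi> p, E p)) p0"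
    and inj': "injective_derivative (\<lambda>p. (\<phi>' p, E p)) p0"
    and zero: "\<phi> p0 = 0" "\<phi>' p0 = 0" "E p0 = 0"
  obtains \<psi> where "biholomorphism_germ \<psi>"
    "\<forall>\<^sub>F z in nhds 0. \<exists>p. E p = 0 \<and> \<phi> p = z \<and> \<phi>' p = \<psi> z"
proof -
  let ?Q = "\<lambda>p. (\<phi> p, E p)" and ?Q' = "\<lambda>p. (\<phi>' p, E p)"
  obtain U1 V1 R where R: "open U1" "open V1" "p0 \<in> U1" "homeomorphism U1 V1 ?Q R"
    "\<And>q. q \<in> V1 \<Longrightarrow> \<exists>R'. (R has_derivative R') (at q) \<and> (\<forall>v. R' (imul v) = imul (R' v))"
    by (rule polyfun_local_inverse[OF \<phi> E inj]) (rule that)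
  obtain U2 V2 S where S: "open U2" "open V2" "p0 \<in> U2" "homeomorphism U2 V2 ?Q' S"
    "\<And>q. q \<in> V2 \<Longrightarrow> \<exists>R'. (S has_derivative R') (at q) \<and> (\<forall>v. R' (imul v) = imul (R' v))"
    by (rule polyfun_local_inverse[OF \<phi>' E inj']) (rule that)
  have Rh: "\<And>p. p \<in> U1 \<Longrightarrow> ?Q p \<in> V1 \<and> R (?Q p) = p" "\<And>q. q \<in> V1 \<Longrightarrow> R q \<in> U1 \<and> ?Q (R q) = q"
    "continuous_on V1 R"
    using R(4) unfolding homeomorphism_def by blast+
  have Sh: "\<And>p. p \<in> U2 \<Longrightarrow> ?Q' p \<in> V2 \<and> S (?Q' p) = p" "\<And>q. q \<in> V2 \<Longrightarrow> S q \<in> U2 \<and> ?Q' (S q) = q"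
    "continuous_on V2 S"
    using S(4) unfolding homeomorphism_def by blast+
  \<comment> \<open>\<open>U\<close> and \<open>V\<close> are the images of
    \<open>{p \<in> U1 \<inter> U2. E p = 0}\<close> under \<open>\<phi>\<close> and
    \<open>\<phi>'\<close>.\<close>
  define U where "U = {z. (z, 0) \<in> V1 \<inter> R -` U2}"
  define V where "V = {z. (z, 0) \<in> V2 \<inter> S -` U1}"
  have slice: "open {z. (z, 0 :: complex ^ idx) \<in> W}" if "open W" for W :: "pt set"
  proof -
    have "open ((\<lambda>z. (z, 0 :: complex ^ idx)) -` W)"
      by (intro open_vimage that continuous_intros)
    then show ?thesis by (simp add: vimage_def)
  qed
  have "open (V1 \<inter> R -` U2)" "open (V2 \<inter> S -` U1)"
    by (auto intro!: continuous_open_preimage Rh Sh R S)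
  then have op: "open U" "open V"
    unfolding U_def V_def by (auto dest: slice)
  define \<psi> \<psi>' where "\<psi> z = \<phi>' (R (z, 0))" and "\<psi>' z = \<phi> (S (z, 0))" for z
  have U: "R (z, 0) \<in> U1 \<inter> U2 \<and> \<phi> (R (z, 0)) = z \<and> E (R (z, 0)) = 0 \<and> \<psi> z \<in> V \<and> \<psi>' (\<psi> z) = z"
    if "z \<in> U" for z
  proof -
    have a: "R (z, 0) \<in> U1 \<inter> U2" "\<phi> (R (z, 0)) = z" "E (R (z, 0)) = 0"
      using that Rh(2)[of "(z, 0)"] by (auto simp: U_def)
    then have "?Q' (R (z, 0)) = (\<psi> z, 0)" by (simp add: \<psi>_def)
    with a Sh(1)[of "R (z, 0)"] have "(\<psi> z, 0) \<in> V2" "S (\<psi> z, 0) = R (z, 0)" by auto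
    with a show ?thesis by (auto simp: V_def \<psi>'_def)
  qed
  have V: "\<psi>' z \<in> U \<and> \<psi> (\<psi>' z) = z" if "z \<in> V" for z
  proof -
    have a: "S (z, 0) \<in> U1 \<inter> U2" "\<phi>' (S (z, 0)) = z" "E (S (z, 0)) = 0"
      using that Sh(2)[of "(z, 0)"] by (auto simp: V_def)
    then have "?Q (S (z, 0)) = (\<psi>' z, 0)" by (simp add: \<psi>'_def)
    with a Rh(1)[of "S (z, 0)"] have "(\<psi>' z, 0) \<in> V1" "R (\<psi>' z, 0) = S (z, 0)" by auto
    with a show ?thesis by (auto simp: U_def \<psi>_def)
  qed
  have "R 0 = p0"
    using Rh(1)[OF R(3)] zero by (simp add: zero_prod_def)
  then have 0: "0 \<in> U" "\<psi> 0 = 0"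
    using Rh(1)[OF R(3)] S(3) zero by (auto simp: U_def \<psi>_def zero_prod_def)
  have hol: "holomorphic_map_on \<psi> U" "holomorphic_map_on \<psi>' V"
    unfolding \<psi>_def \<psi>'_def
    by (auto intro!: holomorphic_map_on_slice \<phi> \<phi>' R(5) S(5) simp: U_def V_def)
  have cont: "continuous_on W f" if "holomorphic_map_on f W" for f W
    using that has_derivative_continuous unfolding holomorphic_map_on_def
    by (intro continuous_at_imp_continuous_on ballI) blast
  have "homeomorphism U V \<psi> \<psi>'"
    using U V hol cont by (intro homeomorphismI) auto
  then have "biholomorphism_germ \<psi>"
    unfolding biholomorphism_germ_def using 0 op hol by blast
  moreover have "\<forall>\<^sub>F z in nhds 0. \<exists>p. E p = 0 \<and> \<phi> p = z \<and> \<phi>' p = \<psi> z"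
    using op(1) 0(1) U unfolding eventually_nhds \<psi>_def by blast
  ultimately show ?thesis using that by blast
qed

text \<open>At \<open>xc = yc = 0\<close> the derivatives of the coefficients drop out. What remains
  is block triangular: the matrix with rows \<open>a, b\<close> and \<open>c, d\<close> on the first
  two coordinates, the identity on the unknowns.\<close>

lemma injective_derivative_chart:
  fixes A B :: "idx \<Rightarrow> pt \<Rightarrow> complex"
  assumes poly: "a \<in> polyfun" "b \<in> polyfun" "c \<in> polyfun" "d \<in> polyfun"
      "\<And>k. A k \<in> polyfun" "\<And>k. B k \<in> polyfun"
    and det: "a (0, e) * d (0, e) \<noteq> b (0, e) * c (0, e)"
  shows "injective_derivative (\<lambda>p. ((xc p * a p + yc p * b p, xc p * c p + yc p * d p),
    \<chi> k. wc k p - e $ k + (xc p * A k p + yc p * B k p))) (0, e)"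
proof -
  let ?p = "(0, e) :: pt"
  have bl: "bounded_linear xc" "bounded_linear yc" "bounded_linear (wc k)" for k
    by (intro bounded_linear_compose[OF bounded_linear_fst bounded_linear_fst]
        bounded_linear_compose[OF bounded_linear_snd bounded_linear_fst]
        bounded_linear_compose[OF bounded_linear_vec_nth bounded_linear_snd])+
  have lin: "((\<lambda>p. xc p * f p + yc p * g p) has_derivative (\<lambda>v. xc v * f ?p + yc v * g ?p)) (at ?p)"
    if fg: "f \<in> polyfun" "g \<in> polyfun" for f g
  proof -
    obtain F G where F: "\<And>p. (f has_derivative F p) (at p)" and G: "\<And>p. (g has_derivative G p) (at p)"
      using fg[THEN polyfun_derivative] by metis
    have "((\<lambda>p. xc p * f p + yc p * g p) has_derivative
        (\<lambda>v. (xc ?p * F ?p v + xc v * f ?p) + (yc ?p * G ?p v + yc v * g ?p))) (at ?p)"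
      by (intro has_derivative_add has_derivative_mult F G bl[THEN bounded_linear_imp_has_derivative])
    then show ?thesis by simp
  qed
  define Q' where "Q' v = ((xc v * a ?p + yc v * b ?p, xc v * c ?p + yc v * d ?p),
      \<chi> k. wc k v - 0 + (xc v * A k ?p + yc v * B k ?p))" for v
  have Q': "((\<lambda>p. ((xc p * a p + yc p * b p, xc p * c p + yc p * d p),
    \<chi> k. wc k p - e $ k + (xc p * A k p + yc p * B k p))) has_derivative Q') (at ?p)"
    unfolding Q'_def
    by (intro has_derivative_Pair has_derivative_vecI lin poly; unfold vec_lambda_beta;
        intro has_derivative_add has_derivative_diff has_derivative_const lin poly
          bl[THEN bounded_linear_imp_has_derivative])
  have "v = 0" if "Q' v = 0" for v
  proof -
    have *: "xc v * a ?p + yc v * b ?p = 0" "xc v * c ?p + yc v * d ?p = 0"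
      and w: "wc k v + (xc v * A k ?p + yc v * B k ?p) = 0" for k
      using that by (auto simp: Q'_def zero_prod_def vec_eq_iff)
    \<comment> \<open>Cramer's rule, applied to the two vanishing components.\<close>
    have "xc v * (a ?p * d ?p - b ?p * c ?p)
        = d ?p * (xc v * a ?p + yc v * b ?p) - b ?p * (xc v * c ?p + yc v * d ?p)"
      "yc v * (a ?p * d ?p - b ?p * c ?p)
        = a ?p * (xc v * c ?p + yc v * d ?p) - c ?p * (xc v * a ?p + yc v * b ?p)"
      by (simp_all add: algebra_simps)
    with * det have "xc v = 0" "yc v = 0" by auto
    with w show ?thesis by (auto simp: prod_eq_iff vec_eq_iff)
  qed
  then show ?thesis
    unfolding injective_derivative_def using has_derivative_unique[OF Q'] by blast
qed

section \<open>Removing the terms of weight at least 11\<close>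

definition normal_form :: "complex \<Rightarrow> complex \<Rightarrow> complex \<Rightarrow> complex \<Rightarrow> complex" where
  "normal_form b c x y = x ^ 3 + b * x ^ 2 * y ^ 3 + y ^ 9 + c * x * y ^ 7"

lemma coeff_monoid_polyfun: "coeff_monoid polyfun"
  by (auto simp: coeff_monoid_def)

primrec xdeg :: "idx \<Rightarrow> nat" where
  "xdeg I0 = 0" | "xdeg I1 = 1" | "xdeg I2 = 2" | "xdeg I3 = 3" | "xdeg I4 = 4"

text \<open>
  These five monomials generate the ideal spanned by the monomials of weight at least 11. The
  truncated difference makes the last one \<open>x\<^sup>4\<close>, of weight 12.
\<close>

definition gen :: "idx \<Rightarrow> pt \<Rightarrow> complex" where
  "gen k p = xc p ^ xdeg k * yc p ^ (11 - 3 * xdeg k)"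

text \<open>
  The coefficients of the generators are required to vanish at \<open>x = y = 0\<close> for every \<open>w\<close>, so that
  such a term does not affect the \<open>w\<close>-derivative of the system there.
\<close>

definition higher :: "(pt \<Rightarrow> complex) \<Rightarrow> bool" where
  "higher f \<longleftrightarrow> (\<exists>A B. (\<forall>k. A k \<in> polyfun \<and> B k \<in> polyfun) \<and>
     f = (\<lambda>p. \<Sum>k\<in>UNIV. gen k p * (xc p * A k p + yc p * B k p)))"

lemma higherI:
  assumes "\<And>k. A k \<in> polyfun" "\<And>k. B k \<in> polyfun"
    and "\<And>p. f p = (\<Sum>k\<in>UNIV. gen k p * (xc p * A k p + yc p * B k p))"
  shows "higher f"
  unfolding higher_def using assms by blast

lemma higher_add:
  assumes "higher f" "higher g"
  shows "higher (\<lambda>p. f p + g p)"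
proof -
  obtain A B A' B' where "\<And>k. A k \<in> polyfun \<and> B k \<in> polyfun" "\<And>k. A' k \<in> polyfun \<and> B' k \<in> polyfun"
    "f = (\<lambda>p. \<Sum>k\<in>UNIV. gen k p * (xc p * A k p + yc p * B k p))"
    "g = (\<lambda>p. \<Sum>k\<in>UNIV. gen k p * (xc p * A' k p + yc p * B' k p))"
    using assms unfolding higher_def by blast
  then show ?thesis
    by (intro higherI[of "\<lambda>k p. A k p + A' k p" "\<lambda>k p. B k p + B' k p"])
      (auto simp: sum.distrib[symmetric] algebra_simps)
qed

lemma higher_cmult:
  assumes "higher f"
  shows "higher (\<lambda>p. c * f p)"
proof -
  obtain A B where "\<And>k. A k \<in> polyfun \<and> B k \<in> polyfun"
    "f = (\<lambda>p. \<Sum>k\<in>UNIV. gen k p * (xc p * A k p + yc p * B k p))"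
    using assms unfolding higher_def by blast
  then show ?thesis
    by (intro higherI[of "\<lambda>k p. c * A k p" "\<lambda>k p. c * B k p"])
      (auto simp: sum_distrib_left algebra_simps)
qed

lemma higher_diff:
  assumes "higher f" "higher g"
  shows "higher (\<lambda>p. f p - g p)"
  using higher_add[OF assms(1) higher_cmult[OF assms(2), of "-1"]] by simp

lemma higher_gen:
  assumes "a \<in> polyfun" "b \<in> polyfun"
  shows "higher (\<lambda>p. gen k p * (xc p * a p + yc p * b p))"
proof -
  have "gen k p * (xc p * a p + yc p * b p)
      = (\<Sum>l\<in>UNIV. if l = k then gen l p * (xc p * a p + yc p * b p) else 0)" for p
    by simp
  also have "\<dots> p = (\<Sum>l\<in>UNIV. gen l p * (xc p * (if l = k then a p else 0)
      + yc p * (if l = k then b p else 0)))" for p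
    by (intro sum.cong) auto
  finally have eq: "(\<lambda>p. gen k p * (xc p * a p + yc p * b p))
      = (\<lambda>p. \<Sum>l\<in>UNIV. gen l p * (xc p * (if l = k then a p else 0)
        + yc p * (if l = k then b p else 0)))" by blast
  have "(\<lambda>p. if l = k then f p else 0) \<in> polyfun" if "f \<in> polyfun" for l f
    using that by (cases "l = k") auto
  with assms eq show ?thesis
    by (intro higherI[of "\<lambda>l p. if l = k then a p else 0" "\<lambda>l p. if l = k then b p else 0"])
      (auto simp: fun_eq_iff)
qed

text \<open>Such a monomial is a multiple of a generator times a further \<open>x\<close> (fact
  \<open>left\<close>, for \<open>i > 4\<close>) or \<open>y\<close> (fact \<open>right\<close>, for
  \<open>i \<le> 4\<close>). The excluded \<open>x ^ 4\<close> is itself a generator.\<close>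

lemma higher_monomial:
  assumes c: "c \<in> polyfun" and ij: "12 \<le> 3 * i + j" "(i, j) \<noteq> (4, 0)"
  shows "higher (\<lambda>p. c p * xc p ^ i * yc p ^ j)"
proof -
  have left: ?thesis if "xdeg k < i" "11 - 3 * xdeg k \<le> j" for k
  proof -
    have "i = xdeg k + 1 + (i - Suc (xdeg k))" "j = 11 - 3 * xdeg k + (j - (11 - 3 * xdeg k))"
      using that by auto
    then obtain l m where lm: "i = xdeg k + 1 + l" "j = 11 - 3 * xdeg k + m" by blast
    have "higher (\<lambda>p. gen k p * (xc p * (c p * xc p ^ l * yc p ^ m) + yc p * 0))"
      by (intro higher_gen polyfun.intros polyfun_power c)
    then show ?thesis by (simp add: lm gen_def power_add mult_ac)
  qed
  have right: ?thesis if "xdeg k \<le> i" "11 - 3 * xdeg k < j" for k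
  proof -
    have "i = xdeg k + (i - (xdeg k))" "j = 11 - 3 * xdeg k + 1 + (j - Suc (11 - 3 * xdeg k))"
      using that by auto
    then obtain l m where lm: "i = xdeg k + l" "j = 11 - 3 * xdeg k + 1 + m" by blast
    have "higher (\<lambda>p. gen k p * (xc p * 0 + yc p * (c p * xc p ^ l * yc p ^ m)))"
      by (intro higher_gen polyfun.intros polyfun_power c)
    then show ?thesis by (simp add: lm gen_def power_add mult_ac)
  qed
  consider "4 < i" | "i = 4" | "i = 3" | "i = 2" | "i = 1" | "i = 0" by linarith
  then show ?thesis
  proof cases
    case 1
    then show ?thesis by (intro left[of I4]) auto
  next
    case 2
    then show ?thesis using ij by (intro right[of I4]) auto
  next
    case 3
    then show ?thesis using ij by (intro right[of I3]) auto
  next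
    case 4
    then show ?thesis using ij by (intro right[of I2]) auto
  next
    case 5
    then show ?thesis using ij by (intro right[of I1]) auto
  next
    case 6
    then show ?thesis using ij by (intro right[of I0]) auto
  qed
qed

text \<open>The bound is 13 rather than 12 because of \<open>x ^ 4\<close>.\<close>

lemma higher_wt:
  assumes "wt polyfun xc yc 13 f"
  shows "higher f"
  using assms by induction (auto intro: higher_monomial higher_add)

text \<open>The factor \<open>y\<close> raises the weight to 12 and rules out
  \<open>x ^ 4\<close>.\<close>

lemma higher_yc_wt:
  assumes "wt polyfun xc yc 11 f"
  shows "higher (\<lambda>p. yc p * f p)"
  using assms
proof induction
  case (wt_monomial c i j)
  then have "higher (\<lambda>p. c p * xc p ^ i * yc p ^ Suc j)"
    by (intro higher_monomial) auto
  then show ?case by (simp add: mult_ac)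
next
  case (wt_add f g)
  from higher_add[OF wt_add.IH] show ?case by (simp add: distrib_left)
qed

text \<open>A monomial of weight at least 11 is a generator or covered by
  \<open>higher_monomial\<close>. The constants \<open>c k\<close> become the values of the unknowns
  at the origin.\<close>

lemma wt_constants_modulo_higher:
  assumes "wt constants xc yc 11 f"
  shows "\<exists>c. higher (\<lambda>p. f p - (\<Sum>k\<in>UNIV. c k * gen k p))"
  using assms
proof induction
  case (wt_monomial a i j)
  then obtain c0 where c0: "a = (\<lambda>_. c0)" by blast
  show ?case
  proof (cases "12 \<le> 3 * i + j \<and> (i, j) \<noteq> (4, 0)")
    case True
    then have "higher (\<lambda>p. a p * xc p ^ i * yc p ^ j)"
      unfolding c0 by (intro higher_monomial) auto
    then show ?thesis by (intro exI[of _ "\<lambda>_. 0"]) simp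
  next
    case False
    have "\<exists>k. i = xdeg k \<and> j = 11 - 3 * xdeg k"
    proof -
      have "i \<le> 4" using False by (cases "i \<le> 4") auto
      then consider "i = 4" | "i = 3" | "i = 2" | "i = 1" | "i = 0" by linarith
      then show ?thesis
      proof cases
        case 1 then show ?thesis using False wt_monomial by (intro exI[of _ I4]) auto
      next
        case 2 then show ?thesis using False wt_monomial by (intro exI[of _ I3]) auto
      next
        case 3 then show ?thesis using False wt_monomial by (intro exI[of _ I2]) auto
      next
        case 4 then show ?thesis using False wt_monomial by (intro exI[of _ I1]) auto
      next
        case 5 then show ?thesis using False wt_monomial by (intro exI[of _ I0]) auto
      qed
    qed
    then obtain k where k: "i = xdeg k" "j = 11 - 3 * xdeg k" by blast
    have "(\<Sum>l\<in>UNIV. (if l = k then c0 else 0) * gen l p) = c0 * gen k p" for p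
    proof -
      have "(\<Sum>l\<in>UNIV. (if l = k then c0 else 0) * gen l p)
          = (\<Sum>l\<in>UNIV. if l = k then c0 * gen l p else 0)"
        by (intro sum.cong) auto
      then show ?thesis by simp
    qed
    moreover have "higher (\<lambda>p. 0)"
      using higher_wt[OF wt_zero[OF coeff_monoid_polyfun]] .
    ultimately show ?thesis
      by (intro exI[of _ "\<lambda>l. if l = k then c0 else 0"]) (simp add: c0 k gen_def mult.assoc)
  qed
next
  case (wt_add f g)
  then obtain c d where "higher (\<lambda>p. f p - (\<Sum>k\<in>UNIV. c k * gen k p))"
    "higher (\<lambda>p. g p - (\<Sum>k\<in>UNIV. d k * gen k p))" by blast
  from higher_add[OF this] show ?case
    by (intro exI[of _ "\<lambda>k. c k + d k"]) (simp add: sum.distrib algebra_simps)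
qed

text \<open>Both \<open>u\<close> and \<open>m\<close> exceed the weights of \<open>x\<close> and
  \<open>y\<close> by 2, so Taylor terms at least quadratic in them gain 4 and reach weight 13. For
  \<open>c * x * y ^ 7\<close>, of weight 10, even the linear terms have weight 12.\<close>

lemma normal_form_displaced:
  fixes u m :: "pt \<Rightarrow> complex"
  assumes u: "wt polyfun xc yc 5 u" and m: "wt polyfun xc yc 3 m"
  shows "higher (\<lambda>p. normal_form b c (xc p + u p) (yc p + m p) - normal_form b c (xc p) (yc p)
    - ((3 * xc p ^ 2 + 2 * b * xc p * yc p ^ 3) * u p
       + (3 * b * xc p ^ 2 * yc p ^ 2 + 9 * yc p ^ 8) * m p))"
proof -
  note P = coeff_monoid_polyfun
  have ym: "wt polyfun xc yc 1 (\<lambda>p. yc p + m p)"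
    by (intro wt_add wt_y[OF P] wt_mono[OF m]) simp
  note a = wt_x[OF P] wt_y[OF P] u m ym wt_const[OF P]
    wt_mult_plus[OF P] wt_power_times[OF P]
  have 1: "wt polyfun xc yc 13 (\<lambda>p. 3 * xc p * u p ^ 2 + u p ^ 3
      + b * (u p ^ 2 * (yc p + m p) ^ 3) 
      + 2 * b * xc p * u p * (3 * yc p ^ 2 * m p) + 2 * b * xc p * u p * (3 * yc p * m p ^ 2)
      + 2 * b * xc p * u p * m p ^ 3
      + b * xc p ^ 2 * (3 * yc p * m p ^ 2) + b * xc p ^ 2 * m p ^ 3)"
    by (intro wt_add; rule wt_mono, (rule a)+, simp)
  have 2: "wt polyfun xc yc 13 (\<lambda>p. 36 * yc p ^ 7 * m p ^ 2 + 84 * yc p ^ 6 * m p ^ 3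
      + 126 * yc p ^ 5 * m p ^ 4 + 126 * yc p ^ 4 * m p ^ 5 + 84 * yc p ^ 3 * m p ^ 6
      + 36 * yc p ^ 2 * m p ^ 7 + 9 * yc p * m p ^ 8 + m p ^ 9)"
    by (intro wt_add; rule wt_mono, (rule a)+, simp)
  have 3: "wt polyfun xc yc 13 (\<lambda>p. c * xc p * (21 * yc p ^ 5 * m p ^ 2)
      + c * xc p * (35 * yc p ^ 4 * m p ^ 3)
      + c * xc p * (35 * yc p ^ 3 * m p ^ 4) + c * xc p * (21 * yc p ^ 2 * m p ^ 5)
      + c * xc p * (7 * yc p * m p ^ 6) + c * xc p * m p ^ 7)"
    by (intro wt_add; rule wt_mono, (rule a)+, simp)
  have 4: "wt polyfun xc yc 13 (\<lambda>p. c * u p * (7 * yc p ^ 6 * m p)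
      + c * u p * (21 * yc p ^ 5 * m p ^ 2) + c * u p * (35 * yc p ^ 4 * m p ^ 3)
      + c * u p * (35 * yc p ^ 3 * m p ^ 4) + c * u p * (21 * yc p ^ 2 * m p ^ 5)
      + c * u p * (7 * yc p * m p ^ 6) + c * u p * m p ^ 7)"
    by (intro wt_add; rule wt_mono, (rule a)+, simp)
  \<comment> \<open>The linear terms of \<open>c * x * y ^ 7\<close> divided by \<open>y\<close>, as
    \<open>higher_yc_wt\<close> expects.\<close>
  have 5: "wt polyfun xc yc 11 (\<lambda>p. 7 * c * xc p * yc p ^ 5 * m p + c * yc p ^ 6 * u p)"
    by (intro wt_add; rule wt_mono, (rule a)+, simp)
  note h = higher_add[OF higher_wt[OF wt_add[OF wt_add[OF 1 2] wt_add[OF 3 4]]] higher_yc_wt[OF 5]]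
  show ?thesis
    by (rule back_subst[of higher, OF h], rule ext, unfold normal_form_def) algebra
qed

text \<open>
  Write \<open>z = y\<^sup>3\<close>, \<open>q1 = 3 x\<^sup>2 + 2 b x z\<close> and \<open>q2 = 9 z\<^sup>2 - 2 b\<^sup>2 x z\<close>; for \<open>c = 0\<close> the partial derivatives
  of the normal form are \<open>q1\<close> and \<open>y\<^sup>2 (b q1 + q2)\<close>. Since
  \<open>(4 b\<^sup>3 + 27) x z\<^sup>2 = 2 b\<^sup>2 z q1 + 3 x q2\<close> and \<open>(4 b\<^sup>3 + 27) x\<^sup>2 z = 9 z q1 - 2 b x q2\<close>, every cubic form
  in \<open>x, z\<close> is a combination of \<open>q1, q2\<close> with linear coefficients, and the displacement below is
  read off from that combination.
\<close>

lemma displacement_linear_part: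
  fixes b x y v w0 w1 w2 w3 w4 W1 W2 :: complex
  assumes \<delta>: "4 * b ^ 3 + 27 \<noteq> 0"
    and W1: "W1 = (1 / (4 * b ^ 3 + 27)) * (w1 + (2 * b ^ 2 / 9) * w0)"
    and W2: "W2 = (1 / (4 * b ^ 3 + 27)) * (w2 - (2 * b / 3) * w3)"
    and v: "v = 3 * W1 - 2 * b * W2"
  shows "(3 * x ^ 2 + 2 * b * x * y ^ 3) *
      (y ^ 2 * (((1 / 3) * w3 - b * v) * x + (9 * W2 + 2 * b ^ 2 * W1 - (b / 9) * w0) * y ^ 3)
        + (1 / 3) * w4 * x ^ 2)
    + (3 * b * x ^ 2 * y ^ 2 + 9 * y ^ 8) * (v * x + (1 / 9) * w0 * y ^ 3)
    = w0 * y ^ 11 + w1 * x * y ^ 8 + w2 * x ^ 2 * y ^ 5 + w3 * x ^ 3 * y ^ 2 + w4 * x ^ 4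
      + (2 * b / 3) * w4 * x ^ 3 * y ^ 3"
proof -
  \<comment> \<open>Solving for \<open>w1\<close> and \<open>w2\<close> clears the denominator
    \<open>4 * b ^ 3 + 27\<close> and leaves a polynomial identity.\<close>
  have w: "w1 = (4 * b ^ 3 + 27) * W1 - (2 * b ^ 2 / 9) * w0" "w2 = (4 * b ^ 3 + 27) * W2 + (2 * b / 3) * w3"
    using \<delta> by (simp_all add: W1 W2)
  show ?thesis
    unfolding w v by (simp add: field_simps) algebra
qed

text \<open>On the surface \<open>E = 0\<close> the normal form at the displaced point equals
  \<open>normal_form + h\<close>, which is \<open>F\<close> after the coordinate change given by
  \<open>a1\<close> to \<open>a4\<close>. Both coordinate maps are charts of the surface, and the
  change of charts is the equivalence.\<close>

lemma right_equivalent_normal_form: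
  fixes F :: "complex \<times> complex \<Rightarrow> complex"
  assumes \<delta>: "4 * b ^ 3 + 27 \<noteq> 0"
    and poly: "a1 \<in> polyfun" "a2 \<in> polyfun" "a3 \<in> polyfun" "a4 \<in> polyfun"
    and det: "\<And>e. a1 (0, e) * a4 (0, e) \<noteq> a2 (0, e) * a3 (0, e)"
    and h: "wt constants xc yc 11 h"
    and F: "\<And>p. F (xc p * a1 p + yc p * a2 p, xc p * a3 p + yc p * a4 p)
      = normal_form b c (xc p) (yc p) + h p"
  shows "right_equivalent F (\<lambda>(x, y). normal_form b c x y)"
proof -
  define W1 where "W1 p = (1 / (4 * b ^ 3 + 27)) * (wc I1 p + (2 * b ^ 2 / 9) * wc I0 p)" for p
  define W2 where "W2 p = (1 / (4 * b ^ 3 + 27)) * (wc I2 p - (2 * b / 3) * wc I3 p)" for p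
  define v where "v p = 3 * W1 p - 2 * b * W2 p" for p
  define s1 where "s1 p = (1 / 3) * wc I3 p - b * v p" for p
  define s2 where "s2 p = 9 * W2 p + 2 * b ^ 2 * W1 p - (b / 9) * wc I0 p" for p
  have W: "W1 \<in> polyfun" "W2 \<in> polyfun"
    unfolding W1_def[abs_def] W2_def[abs_def]
    by (intro polyfun.intros polyfun_diff)+
  have v: "v \<in> polyfun"
    unfolding v_def[abs_def] by (intro polyfun.intros polyfun_diff W)
  have s: "s1 \<in> polyfun" "s2 \<in> polyfun"
    unfolding s1_def[abs_def] s2_def[abs_def]
    by (intro polyfun.intros polyfun_diff v W)+
  define u where "u p = yc p ^ 2 * (s1 p * xc p + s2 p * yc p ^ 3) + (1 / 3) * wc I4 p * xc p ^ 2" for p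
  define m where "m p = v p * xc p + (1 / 9) * wc I0 p * yc p ^ 3" for p
  note P = coeff_monoid_polyfun
  note a = wt_x[OF P] wt_y[OF P] wt_coeff_self[OF P v] wt_coeff_self[OF P s(1)]
    wt_coeff_self[OF P s(2)] wt_coeff_self[OF P polyfun.w] wt_const[OF P]
    wt_mult_plus[OF P] wt_power_times[OF P]
  \<comment> \<open>This sum sits inside a product, where \<open>wt_add\<close> does not reach it,
    so its weight is recorded first.\<close>
  have "wt polyfun xc yc 3 (\<lambda>p. s1 p * xc p + s2 p * yc p ^ 3)"
    by (intro wt_add; rule wt_mono, (rule a)+, simp)
  note a' = this a
  have u: "wt polyfun xc yc 5 u"
    unfolding u_def[abs_def] by (intro wt_add; rule wt_mono, (rule a')+, simp)
  have m: "wt polyfun xc yc 3 m"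
    unfolding m_def[abs_def] by (intro wt_add; rule wt_mono, (rule a)+, simp)
  obtain c0 where c0: "higher (\<lambda>p. h p - (\<Sum>k\<in>UNIV. c0 k * gen k p))"
    using wt_constants_modulo_higher[OF h] by blast
  \<comment> \<open>The extra term of \<open>displacement_linear_part\<close>: the
    \<open>x ^ 2\<close> term of \<open>u\<close> times \<open>2 * b * x * y ^ 3\<close>.\<close>
  have "higher (\<lambda>p. ((2 * b / 3) * wc I4 p) * xc p ^ 3 * yc p ^ 3)"
    by (intro higher_monomial polyfun.intros) auto
  note H = higher_diff[OF higher_add[OF normal_form_displaced[OF u m, of b c] this] c0]
  have "higher (\<lambda>p. normal_form b c (xc p + u p) (yc p + m p)
      - (normal_form b c (xc p) (yc p) + h p) - (\<Sum>k\<in>UNIV. (wc k p - c0 k) * gen k p))"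
  proof (rule back_subst[of higher, OF H], rule ext)
    fix p
    have "(3 * xc p ^ 2 + 2 * b * xc p * yc p ^ 3) * u p
        + (3 * b * xc p ^ 2 * yc p ^ 2 + 9 * yc p ^ 8) * m p
      = (\<Sum>k\<in>UNIV. wc k p * gen k p) + ((2 * b / 3) * wc I4 p) * xc p ^ 3 * yc p ^ 3"
      unfolding u_def m_def s1_def s2_def
        displacement_linear_part[OF \<delta> W1_def[of p] W2_def[of p] v_def[of p]]
      by (simp add: UNIV_idx gen_def mult_ac)
    then show "normal_form b c (xc p + u p) (yc p + m p) - normal_form b c (xc p) (yc p)
      - ((3 * xc p ^ 2 + 2 * b * xc p * yc p ^ 3) * u p
        + (3 * b * xc p ^ 2 * yc p ^ 2 + 9 * yc p ^ 8) * m p)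
      + ((2 * b / 3) * wc I4 p) * xc p ^ 3 * yc p ^ 3 - (h p - (\<Sum>k\<in>UNIV. c0 k * gen k p))
      = normal_form b c (xc p + u p) (yc p + m p)
      - (normal_form b c (xc p) (yc p) + h p) - (\<Sum>k\<in>UNIV. (wc k p - c0 k) * gen k p)"
      by (simp add: left_diff_distrib sum_subtractf)
  qed
  then obtain A B where AB: "\<And>k. A k \<in> polyfun" "\<And>k. B k \<in> polyfun"
    and eq: "\<And>p. normal_form b c (xc p + u p) (yc p + m p)
      - (normal_form b c (xc p) (yc p) + h p) - (\<Sum>k\<in>UNIV. (wc k p - c0 k) * gen k p)
      = (\<Sum>k\<in>UNIV. gen k p * (xc p * A k p + yc p * B k p))"
    unfolding higher_def fun_eq_iff by blast
  \<comment> \<open>\<open>E p = 0\<close> compares the coefficients of the generators; over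
    \<open>x = y = 0\<close> its solution is \<open>w = e\<close>.\<close>
  define e :: "complex ^ idx" where "e = (\<chi> k. c0 k)"
  define E where "E p = (\<chi> k. wc k p - e $ k + (xc p * A k p + yc p * B k p))" for p
  define \<phi> where "\<phi> p = (xc p * a1 p + yc p * a2 p, xc p * a3 p + yc p * a4 p)" for p
  \<comment> \<open>These bring the displaced point into the form used in
    \<open>injective_derivative_chart\<close>. Over the origin its matrix has rows
    \<open>1, 0\<close> and \<open>v, 1\<close>, of determinant 1.\<close>
  define d1 d2 d4 where "d1 p = 1 + (1 / 3) * wc I4 p * xc p"
    and "d2 p = yc p * (s1 p * xc p + s2 p * yc p ^ 3)"
    and "d4 p = 1 + (1 / 9) * wc I0 p * yc p ^ 2" for p
  define \<phi>' where "\<phi>' p = (xc p * d1 p + yc p * d2 p, xc p * v p + yc p * d4 p)" for p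
  have \<phi>': "\<phi>' p = (xc p + u p, yc p + m p)" for p
    by (simp add: \<phi>'_def d1_def d2_def d4_def u_def m_def algebra_simps power2_eq_square power3_eq_cube)
  have d: "d1 \<in> polyfun" "d2 \<in> polyfun" "d4 \<in> polyfun"
    unfolding d1_def[abs_def] d2_def[abs_def] d4_def[abs_def]
    by (intro polyfun.intros polyfun_power s)+
  have sum: "normal_form b c (xc p + u p) (yc p + m p)
      = normal_form b c (xc p) (yc p) + h p + (\<Sum>k\<in>UNIV. gen k p * E p $ k)" for p
    using eq[of p] by (simp add: E_def e_def distrib_left sum.distrib mult.commute diff_eq_eq add_ac)
  obtain \<psi> where \<psi>: "biholomorphism_germ \<psi>"
    "\<forall>\<^sub>F z in nhds 0. \<exists>p. E p = 0 \<and> \<phi> p = z \<and> \<phi>' p = \<psi> z"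
  proof (rule biholomorphism_germ_between_charts[of \<phi> \<phi>' E "(0, e)"])
    show "injective_derivative (\<lambda>p. (\<phi> p, E p)) (0, e)"
      unfolding \<phi>_def E_def by (intro injective_derivative_chart poly AB det)
    show "injective_derivative (\<lambda>p. (\<phi>' p, E p)) (0, e)"
      unfolding \<phi>'_def E_def
      by (intro injective_derivative_chart d v AB) (simp add: d1_def d2_def d4_def)
    show "(\<lambda>p. E p $ k) \<in> polyfun" for k
      unfolding E_def vec_lambda_beta by (intro polyfun.intros polyfun_diff AB)
  qed (auto simp: \<phi>_def \<phi>'_def E_def zero_prod_def vec_eq_iff
      intro!: polyfun.intros poly d v)
  have "\<forall>\<^sub>F z in nhds 0. F z = (\<lambda>(x, y). normal_form b c x y) (\<psi> z)"
    using \<psi>(2)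
  proof eventually_elim
    case (elim z)
    then obtain p where p: "E p = 0" "\<phi> p = z" "(xc p + u p, yc p + m p) = \<psi> z"
      unfolding \<phi>' by blast
    have "F z = normal_form b c (xc p) (yc p) + h p"
      using F[of p] p(2) by (simp add: \<phi>_def)
    also have "\<dots> = normal_form b c (xc p + u p) (yc p + m p)"
      using sum[of p] p(1) by simp
    finally show ?case by (simp flip: p(3))
  qed
  with \<psi>(1) show ?thesis unfolding right_equivalent_def by blast
qed

section \<open>Reduction to the normal form\<close>

text \<open>Let \<open>P\<close> be the cubic with coefficients \<open>a3, a2, a1, a0\<close>. As
  \<open>s\<close> is a zero of its derivative, \<open>x \<mapsto> x + s * y ^ 3\<close> removes
  \<open>x * y ^ 6\<close> and leaves \<open>3 * a3 * s + a2\<close> at \<open>x ^ 2 * y ^ 3\<close>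
  and \<open>P s\<close> at \<open>y ^ 9\<close>. The last two hypotheses together say that the
  discriminant is nonzero.\<close>

lemma right_equivalent_J30:
  fixes R :: "complex \<times> complex \<Rightarrow> complex"
  assumes R: "wt constants fst snd 10 R"
    and F: "\<And>x y. F (x, y) = a3 * x ^ 3 + a2 * x ^ 2 * y ^ 3 + a1 * x * y ^ 6 + a0 * y ^ 9 + R (x, y)"
    and a3: "a3 \<noteq> 0" and s: "3 * a3 * s ^ 2 + 2 * a2 * s + a1 = 0"
    and D: "a3 * s ^ 3 + a2 * s ^ 2 + a1 * s + a0 \<noteq> 0"
    and \<delta>: "4 * (3 * a3 * s + a2) ^ 3 + 27 * a3 ^ 2 * (a3 * s ^ 3 + a2 * s ^ 2 + a1 * s + a0) \<noteq> 0"
  shows "\<exists>g\<in>J30. right_equivalent F g"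
proof -
  define D where "D = a3 * s ^ 3 + a2 * s ^ 2 + a1 * s + a0"
  obtain \<alpha> where \<alpha>: "\<alpha> \<noteq> 0" "1 / a3 = \<alpha> ^ 3"
    using exists_complex_root_nonzero[of "1 / a3" 3] a3 by auto
  obtain \<mu> where \<mu>: "\<mu> \<noteq> 0" "1 / D = \<mu> ^ 9"
    using exists_complex_root_nonzero[of "1 / D" 9] D by (auto simp: D_def)
  define b where "b = (3 * a3 * s + a2) * \<alpha> ^ 2 * \<mu> ^ 3"
  have \<alpha>3: "a3 * \<alpha> ^ 3 = 1" and \<mu>9: "D * \<mu> ^ 9 = 1"
    using a3 D by (simp_all add: D_def flip: \<alpha>(2) \<mu>(2))
  have "(a3 ^ 2 * D) * (4 * b ^ 3 + 27) = 4 * (3 * a3 * s + a2) ^ 3 * (a3 * \<alpha> ^ 3) ^ 2 * (D * \<mu> ^ 9)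
      + 27 * a3 ^ 2 * D"
    unfolding b_def by algebra
  with \<delta> have b: "4 * b ^ 3 + 27 \<noteq> 0"
    unfolding \<alpha>3 \<mu>9 by (auto simp: D_def)
  \<comment> \<open>\<open>s\<close> was chosen to remove the term in \<open>x y\<^sup>6\<close>; \<open>\<alpha>\<close> and \<open>\<mu>\<close> normalize the two outer terms.\<close>
  define S where "S z = R (\<alpha> * fst z + s * (\<mu> * snd z) ^ 3, \<mu> * snd z)" for z
  have F': "F (\<alpha> * X + s * (\<mu> * Y) ^ 3, \<mu> * Y) = X ^ 3 + b * X ^ 2 * Y ^ 3 + Y ^ 9 + S (X, Y)" for X Y
  proof -
    have a1: "a1 = - 3 * a3 * s ^ 2 - 2 * a2 * s" using s by algebra
    have "a3 * (\<alpha> * X + s * (\<mu> * Y) ^ 3) ^ 3 + a2 * (\<alpha> * X + s * (\<mu> * Y) ^ 3) ^ 2 * (\<mu> * Y) ^ 3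
        + a1 * (\<alpha> * X + s * (\<mu> * Y) ^ 3) * (\<mu> * Y) ^ 6 + a0 * (\<mu> * Y) ^ 9
      = (a3 * \<alpha> ^ 3) * X ^ 3 + b * X ^ 2 * Y ^ 3 + (D * \<mu> ^ 9) * Y ^ 9"
      unfolding b_def D_def a1 by algebra
    then show ?thesis unfolding \<alpha>3 \<mu>9 by (simp add: F S_def)
  qed
  note C = coeff_monoid_constants
  have "wt constants fst snd 10 S"
    unfolding S_def[abs_def]
  proof (rule wt_subst[OF C])
    show "wt constants (\<lambda>z. fst (\<alpha> * fst z + s * (\<mu> * snd z) ^ 3, \<mu> * snd z))
        (\<lambda>z. snd (\<alpha> * fst z + s * (\<mu> * snd z) ^ 3, \<mu> * snd z)) 10
        (\<lambda>z. R (\<alpha> * fst z + s * (\<mu> * snd z) ^ 3, \<mu> * snd z))"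
      by (rule wt_constants_comp[OF R])
    note a = wt_x[OF C] wt_y[OF C] wt_const[OF C] wt_mult_plus[OF C] wt_power_times[OF C]
    show "wt constants fst snd 3 (\<lambda>z :: complex \<times> complex. fst (\<alpha> * fst z + s * (\<mu> * snd z) ^ 3, \<mu> * snd z))"
      unfolding fst_conv by (intro wt_add; rule wt_mono, (rule a)+, simp)
    show "wt constants fst snd 1 (\<lambda>z :: complex \<times> complex. snd (\<alpha> * fst z + s * (\<mu> * snd z) ^ 3, \<mu> * snd z))"
      unfolding snd_conv by (rule wt_mono, (rule a)+, simp)
  qed
  then obtain k T where T: "wt constants fst snd 11 T"
    and S: "\<And>z. S z = (\<Sum>i\<le>10 div 3. k i * fst z ^ i * snd z ^ (10 - 3 * i)) + T z"
    by (rule wt_leading_part) (simp add: that)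
  have S: "S (X, Y) = k 0 * Y ^ 10 + k 1 * X * Y ^ 7 + k 2 * X ^ 2 * Y ^ 4 + k 3 * X ^ 3 * Y + T (X, Y)" for X Y
  proof -
    have "{..10 div 3} = {0, 1, 2, 3 :: nat}" by auto
    then show ?thesis unfolding S by simp
  qed
  \<comment> \<open>\<open>p, q, r\<close> kill the part of weight 10 up to a multiple of \<open>x y\<^sup>7\<close>.\<close>
  define p r where "p = - k 3 / 3" and "r = - k 0 / 9"
  define q where "q = (- k 2 - 2 * b * p - 3 * b * r) / 3"
  define c where "c = k 1 + 2 * b * q"
  \<comment> \<open>The coefficient equations of \<open>x ^ 3 * y\<close>, \<open>y ^ 10\<close>,
    \<open>x ^ 2 * y ^ 4\<close> and \<open>x * y ^ 7\<close>, in this order.\<close>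
  have k: "k 3 = - 3 * p" "k 0 = - 9 * r" "k 2 = - 3 * q - 2 * b * p - 3 * b * r" "k 1 = c - 2 * b * q"
    by (simp_all add: p_def r_def q_def c_def field_simps)
  define u v :: "pt \<Rightarrow> complex"
    where "u z = yc z * (p * xc z + q * yc z ^ 3)" and "v z = r * yc z ^ 2" for z
  define X Y where "X z = xc z + u z" and "Y z = yc z + v z" for z
  note a = wt_x[OF C] wt_y[OF C] wt_const[OF C] wt_mult_plus[OF C] wt_power_times[OF C]
  have "wt constants xc yc 3 (\<lambda>z. p * xc z + q * yc z ^ 3)"
    by (intro wt_add; rule wt_mono, (rule a)+, simp)
  note a' = this a
  have u: "wt constants xc yc 4 u"
    unfolding u_def[abs_def] by (rule wt_mono, (rule a')+, simp)
  have v: "wt constants xc yc 2 v"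
    unfolding v_def[abs_def] by (rule wt_mono, (rule a)+, simp)
  have X: "wt constants xc yc 3 X"
    unfolding X_def[abs_def] by (intro wt_add wt_x[OF C] wt_mono[OF u]) simp
  have Y: "wt constants xc yc 1 Y"
    unfolding Y_def[abs_def] by (intro wt_add wt_y[OF C] wt_mono[OF v]) simp
  define h where "h z = X z ^ 3 + b * X z ^ 2 * Y z ^ 3 + Y z ^ 9 + S (X z, Y z)
    - normal_form b c (xc z) (yc z)" for z
  have "wt constants (\<lambda>z. fst (X z, Y z)) (\<lambda>z. snd (X z, Y z)) 11 (\<lambda>z. T (X z, Y z))"
    by (rule wt_constants_comp[OF T])
  then have T': "wt constants xc yc 11 (\<lambda>z. T (X z, Y z))"
    by (intro wt_subst[OF C _ X Y]) simp
  note a = u v X Y a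
  \<comment> \<open>\<open>u\<close> and \<open>v\<close> raise the weight by 1. Facts
    \<open>1\<close> and \<open>2\<close> collect the terms at least quadratic in them from the part
    of weight 9, facts \<open>3\<close> to \<open>6\<close> the terms at least linear from the part
    of weight 10.\<close>
  have 1: "wt constants xc yc 11 (\<lambda>z. 3 * xc z * u z ^ 2 + u z ^ 3
      + b * u z ^ 2 * Y z ^ 3 + b * 2 * xc z * u z * (3 * yc z ^ 2 * v z)
      + b * 2 * xc z * u z * (3 * yc z * v z ^ 2) + b * 2 * xc z * u z * v z ^ 3
      + b * xc z ^ 2 * (3 * yc z * v z ^ 2) + b * xc z ^ 2 * v z ^ 3)"
    by (intro wt_add; rule wt_mono, (rule a)+, simp)
  have 2: "wt constants xc yc 11 (\<lambda>z. 36 * yc z ^ 7 * v z ^ 2 + 84 * yc z ^ 6 * v z ^ 3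
      + 126 * yc z ^ 5 * v z ^ 4 + 126 * yc z ^ 4 * v z ^ 5 + 84 * yc z ^ 3 * v z ^ 6
      + 36 * yc z ^ 2 * v z ^ 7 + 9 * yc z * v z ^ 8 + v z ^ 9)"
    by (intro wt_add; rule wt_mono, (rule a)+, simp)
  have 3: "wt constants xc yc 11 (\<lambda>z. k 0 * 10 * yc z ^ 9 * v z + k 0 * 45 * yc z ^ 8 * v z ^ 2
      + k 0 * 120 * yc z ^ 7 * v z ^ 3 + k 0 * 210 * yc z ^ 6 * v z ^ 4 + k 0 * 252 * yc z ^ 5 * v z ^ 5
      + k 0 * 210 * yc z ^ 4 * v z ^ 6 + k 0 * 120 * yc z ^ 3 * v z ^ 7 + k 0 * 45 * yc z ^ 2 * v z ^ 8
      + k 0 * 10 * yc z * v z ^ 9 + k 0 * v z ^ 10)"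
    by (intro wt_add; rule wt_mono, (rule a)+, simp)
  have 4: "wt constants xc yc 11 (\<lambda>z. k 1 * u z * Y z ^ 7 + k 1 * xc z * (7 * yc z ^ 6 * v z)
      + k 1 * xc z * (21 * yc z ^ 5 * v z ^ 2) + k 1 * xc z * (35 * yc z ^ 4 * v z ^ 3)
      + k 1 * xc z * (35 * yc z ^ 3 * v z ^ 4) + k 1 * xc z * (21 * yc z ^ 2 * v z ^ 5)
      + k 1 * xc z * (7 * yc z * v z ^ 6) + k 1 * xc z * v z ^ 7)"
    by (intro wt_add; rule wt_mono, (rule a)+, simp)
  have 5: "wt constants xc yc 11 (\<lambda>z. k 2 * 2 * xc z * u z * Y z ^ 4 + k 2 * u z ^ 2 * Y z ^ 4
      + k 2 * xc z ^ 2 * (4 * yc z ^ 3 * v z) + k 2 * xc z ^ 2 * (6 * yc z ^ 2 * v z ^ 2)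
      + k 2 * xc z ^ 2 * (4 * yc z * v z ^ 3) + k 2 * xc z ^ 2 * v z ^ 4)"
    by (intro wt_add; rule wt_mono, (rule a)+, simp)
  have 6: "wt constants xc yc 11 (\<lambda>z. k 3 * 3 * xc z ^ 2 * u z * Y z + k 3 * 3 * xc z * u z ^ 2 * Y z
      + k 3 * u z ^ 3 * Y z + k 3 * xc z ^ 3 * v z)"
    by (intro wt_add; rule wt_mono, (rule a)+, simp)
  note h' = wt_add[OF wt_add[OF wt_add[OF 1 2] wt_add[OF 3 4]] wt_add[OF wt_add[OF 5 6] T']]
  have h: "wt constants xc yc 11 h"
  proof (rule back_subst[of "wt constants xc yc 11", OF h'], rule ext)
    fix z
    have lin: "3 * xc z ^ 2 * u z + b * (2 * xc z * u z * yc z ^ 3 + 3 * xc z ^ 2 * yc z ^ 2 * v z)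
        + 9 * yc z ^ 8 * v z + k 0 * yc z ^ 10 + k 1 * xc z * yc z ^ 7 + k 2 * xc z ^ 2 * yc z ^ 4
        + k 3 * xc z ^ 3 * yc z = c * xc z * yc z ^ 7"
      unfolding k u_def v_def by algebra
    show "3 * xc z * u z ^ 2 + u z ^ 3
      + b * u z ^ 2 * Y z ^ 3 + b * 2 * xc z * u z * (3 * yc z ^ 2 * v z)
      + b * 2 * xc z * u z * (3 * yc z * v z ^ 2) + b * 2 * xc z * u z * v z ^ 3
      + b * xc z ^ 2 * (3 * yc z * v z ^ 2) + b * xc z ^ 2 * v z ^ 3
      + (36 * yc z ^ 7 * v z ^ 2 + 84 * yc z ^ 6 * v z ^ 3
      + 126 * yc z ^ 5 * v z ^ 4 + 126 * yc z ^ 4 * v z ^ 5 + 84 * yc z ^ 3 * v z ^ 6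
      + 36 * yc z ^ 2 * v z ^ 7 + 9 * yc z * v z ^ 8 + v z ^ 9)
      + (k 0 * 10 * yc z ^ 9 * v z + k 0 * 45 * yc z ^ 8 * v z ^ 2
      + k 0 * 120 * yc z ^ 7 * v z ^ 3 + k 0 * 210 * yc z ^ 6 * v z ^ 4 + k 0 * 252 * yc z ^ 5 * v z ^ 5
      + k 0 * 210 * yc z ^ 4 * v z ^ 6 + k 0 * 120 * yc z ^ 3 * v z ^ 7 + k 0 * 45 * yc z ^ 2 * v z ^ 8
      + k 0 * 10 * yc z * v z ^ 9 + k 0 * v z ^ 10
      + (k 1 * u z * Y z ^ 7 + k 1 * xc z * (7 * yc z ^ 6 * v z)
      + k 1 * xc z * (21 * yc z ^ 5 * v z ^ 2) + k 1 * xc z * (35 * yc z ^ 4 * v z ^ 3)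
      + k 1 * xc z * (35 * yc z ^ 3 * v z ^ 4) + k 1 * xc z * (21 * yc z ^ 2 * v z ^ 5)
      + k 1 * xc z * (7 * yc z * v z ^ 6) + k 1 * xc z * v z ^ 7))
      + (k 2 * 2 * xc z * u z * Y z ^ 4 + k 2 * u z ^ 2 * Y z ^ 4
      + k 2 * xc z ^ 2 * (4 * yc z ^ 3 * v z) + k 2 * xc z ^ 2 * (6 * yc z ^ 2 * v z ^ 2)
      + k 2 * xc z ^ 2 * (4 * yc z * v z ^ 3) + k 2 * xc z ^ 2 * v z ^ 4
      + (k 3 * 3 * xc z ^ 2 * u z * Y z + k 3 * 3 * xc z * u z ^ 2 * Y z
      + k 3 * u z ^ 3 * Y z + k 3 * xc z ^ 3 * v z) + T (X z, Y z)) = h z"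
      unfolding h_def S normal_form_def lin[symmetric] X_def Y_def by algebra
  qed
  have "right_equivalent F (\<lambda>(x, y). normal_form b c x y)"
  proof (rule right_equivalent_normal_form[OF b _ _ _ _ _ h])
    \<comment> \<open>The composite of the two coordinate changes; over the origin its matrix has
      rows \<open>\<alpha>, 0\<close> and \<open>0, \<mu>\<close>.\<close>
    let ?a2 = "\<lambda>z. \<alpha> * (p * xc z + q * yc z ^ 3) + s * \<mu> ^ 3 * yc z ^ 2 * (1 + r * yc z) ^ 3"
    let ?a4 = "\<lambda>z. \<mu> * (1 + r * yc z)"
    show "F (xc z * \<alpha> + yc z * ?a2 z, xc z * 0 + yc z * ?a4 z)
      = normal_form b c (xc z) (yc z) + h z" for z
    proof -
      have "xc z * \<alpha> + yc z * ?a2 z = \<alpha> * X z + s * (\<mu> * Y z) ^ 3"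
        unfolding X_def Y_def u_def v_def by algebra
      moreover have "xc z * 0 + yc z * ?a4 z = \<mu> * Y z"
        unfolding Y_def v_def by algebra
      ultimately show ?thesis by (simp only: F') (simp add: h_def)
    qed
    show "(\<lambda>_. \<alpha>) \<in> polyfun" "?a2 \<in> polyfun" "(\<lambda>_. 0) \<in> polyfun" "?a4 \<in> polyfun"
      by (intro polyfun.intros polyfun_power)+
  qed (use \<alpha> \<mu> in simp)
  moreover have "(\<lambda>(x, y). normal_form b c x y) \<in> J30"
    unfolding J30_def normal_form_def using b by blast
  ultimately show ?thesis by blast
qed

section \<open>Taylor coefficients and deformations\<close>

lemma higher_deriv_polynomial_at_0:
  fixes c :: "nat \<Rightarrow> complex"
  shows "(deriv ^^ j) (\<lambda>y. \<Sum>k\<le>N. c k * y ^ k) 0 = (if j \<le> N then fact j * c j else 0)"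
proof -
  define q where "q = (\<Sum>k\<le>N. monom (c k) k)"
  have "deriv (poly r) = poly (pderiv r)" for r :: "complex poly"
    by (intro ext DERIV_imp_deriv poly_DERIV)
  then have "(deriv ^^ j) (poly r) = poly ((pderiv ^^ j) r)" for r :: "complex poly"
    by (induction j) simp_all
  moreover have "(\<lambda>y. \<Sum>k\<le>N. c k * y ^ k) = poly q"
    by (simp add: q_def poly_sum poly_monom fun_eq_iff)
  ultimately have "(deriv ^^ j) (\<lambda>y. \<Sum>k\<le>N. c k * y ^ k) 0 = coeff ((pderiv ^^ j) q) 0"
    by (simp add: poly_0_coeff_0)
  also have "\<dots> = fact j * coeff q j"
    by (simp add: coeff_higher_pderiv pochhammer_fact)
  also have "coeff q j = (if j \<le> N then c j else 0)"
    by (simp add: q_def coeff_sum)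
  finally show ?thesis by simp
qed

lemma taylor_coeff_polynomial:
  assumes "\<And>x y. f (x, y) = (\<Sum>i\<le>N. \<Sum>j\<le>N. a i j * x ^ i * y ^ j)" "i \<le> N" "j \<le> N"
  shows "taylor_coeff f i j = a i j"
proof -
  have "f (x, y) = (\<Sum>j\<le>N. (\<Sum>i\<le>N. a i j * x ^ i) * y ^ j)" for x y
    unfolding assms(1) by (subst sum.swap) (simp add: sum_distrib_right)
  then have "(\<lambda>x. (deriv ^^ j) (\<lambda>y. f (x, y)) 0) = (\<lambda>x. \<Sum>i\<le>N. (fact j * a i j) * x ^ i)"
    using assms(3) by (simp add: higher_deriv_polynomial_at_0 sum_distrib_left mult.assoc)
  then show ?thesis
    using assms(2) by (simp add: taylor_coeff_def higher_deriv_polynomial_at_0)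
qed

text \<open>Every nonzero \<open>a i j\<close> is a Taylor coefficient of \<open>f\<close>, so its
  weight is at least the infimum.\<close>

lemma wt_of_fil:
  assumes f: "\<And>x y. f (x, y) = (\<Sum>i\<le>N. \<Sum>j\<le>N. a i j * x ^ i * y ^ j)"
    and d: "fil (3, 1) f \<ge> enat d"
  shows "wt constants fst snd d f"
proof -
  note C = coeff_monoid_constants
  have "wt constants fst snd d (\<lambda>z. a i j * fst z ^ i * snd z ^ j)" if "i \<le> N" "j \<le> N" for i j
  proof (cases "a i j = 0")
    case False
    have "enat d \<le> (INF (i, j) \<in> {(i, j). taylor_coeff f i j \<noteq> 0}. enat (3 * i + j))"
      using d by (simp add: fil_def)
    also have "\<dots> \<le> enat (3 * i + j)"
      using False taylor_coeff_polynomial[OF f that] by (intro INF_lower2[of "(i, j)"]) auto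
    finally show ?thesis by (intro wt_monomial) auto
  qed (simp add: wt_zero[OF C])
  then have "wt constants fst snd d (\<lambda>z. \<Sum>i\<le>N. \<Sum>j\<le>N. a i j * fst z ^ i * snd z ^ j)"
    by (intro wt_sum[OF C]) auto
  moreover have "f = (\<lambda>z. \<Sum>i\<le>N. \<Sum>j\<le>N. a i j * fst z ^ i * snd z ^ j)"
    using f by auto
  ultimately show ?thesis by simp
qed

section \<open>Polynomials as convergent power series\<close>

lemma analytic_germ_monomial:
  assumes "\<beta> \<in> tuples n"
  shows "analytic_germ n (\<lambda>z. c * (\<Prod>i<n. z i ^ \<beta> i))"
  unfolding analytic_germ_def
proof (intro exI[of _ "\<lambda>\<alpha>. if \<alpha> = \<beta> then c else 0"] exI[of _ "1 :: real"] conjI ballI impI)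
  fix z :: "nat \<Rightarrow> complex"
  show "((\<lambda>\<alpha>. (if \<alpha> = \<beta> then c else 0) * (\<Prod>i<n. z i ^ \<alpha> i)) has_sum c * (\<Prod>i<n. z i ^ \<beta> i)) (tuples n)"
    by (rule has_sum_finite_neutralI[of "{\<beta>}"]) (use assms in auto)
qed simp

lemma analytic_germ_add:
  assumes "analytic_germ n F" "analytic_germ n G"
  shows "analytic_germ n (\<lambda>z. F z + G z)"
proof -
  obtain a r where
    F: "r > 0" "\<And>z. z \<in> tuples n \<Longrightarrow> \<forall>i<n. cmod (z i) < r \<Longrightarrow>
      ((\<lambda>\<alpha>. a \<alpha> * (\<Prod>i<n. z i ^ \<alpha> i)) has_sum F z) (tuples n)"
    using assms(1) unfolding analytic_germ_def by blast
  obtain b s where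
    G: "s > 0" "\<And>z. z \<in> tuples n \<Longrightarrow> \<forall>i<n. cmod (z i) < s \<Longrightarrow>
      ((\<lambda>\<alpha>. b \<alpha> * (\<Prod>i<n. z i ^ \<alpha> i)) has_sum G z) (tuples n)"
    using assms(2) unfolding analytic_germ_def by blast
  show ?thesis
    unfolding analytic_germ_def
  proof (intro exI[of _ "\<lambda>\<alpha>. a \<alpha> + b \<alpha>"] exI[of _ "min r s"] conjI ballI impI)
    fix z :: "nat \<Rightarrow> complex"
    assume "z \<in> tuples n" "\<forall>i<n. cmod (z i) < min r s"
    then show "((\<lambda>\<alpha>. (a \<alpha> + b \<alpha>) * (\<Prod>i<n. z i ^ \<alpha> i)) has_sum F z + G z) (tuples n)"
      unfolding distrib_right by (intro has_sum_add F G) auto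
  qed (use F G in simp)
qed

lemma analytic_germ_sum:
  assumes "finite S" "\<And>s. s \<in> S \<Longrightarrow> analytic_germ n (F s)"
  shows "analytic_germ n (\<lambda>z. \<Sum>s\<in>S. F s z)"
  using assms
proof (induction S rule: finite_induct)
  case empty
  show ?case
    using analytic_germ_monomial[of "\<lambda>_. 0" n 0] by (simp add: tuples_def)
qed (simp add: analytic_germ_add)

text \<open>Coordinates 0 and 1 are \<open>x\<close> and \<open>y\<close>; 2 and 3 are the two
  parameters of the deformation.\<close>

lemma analytic_germ_monomial4: "analytic_germ 4 (\<lambda>z. c * z 0 ^ i * z 1 ^ j * z 2 ^ k * z 3 ^ l)"
proof -
  define \<beta> :: "nat \<Rightarrow> nat" where
    "\<beta> = (\<lambda>n. if n = 0 then i else if n = 1 then j else if n = 2 then k else if n = 3 then l else 0)"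
  have "{..<4} = {0, 1, 2, 3 :: nat}" by auto
  then have "(\<Prod>n<4. z n ^ \<beta> n) = z 0 ^ i * z 1 ^ j * z 2 ^ k * z 3 ^ l" for z :: "nat \<Rightarrow> complex"
    by (simp add: \<beta>_def mult.assoc)
  moreover have "\<beta> \<in> tuples 4" by (auto simp: \<beta>_def tuples_def)
  ultimately show ?thesis using analytic_germ_monomial[of \<beta> 4 c] by (simp add: mult.assoc)
qed

section \<open>Generic small parameters and the deformation\<close>

lemma exists_small_avoiding:
  fixes S :: "complex set"
  assumes "finite S" "\<epsilon> > 0"
  obtains t where "cmod t < \<epsilon>" "t \<notin> S"
proof -
  have "infinite (ball (0 :: complex) \<epsilon>)"
    using assms(2) uncountable_ball countable_finite by blast
  then have "\<not> ball 0 \<epsilon> \<subseteq> S" using assms(1) finite_subset by blast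
  then obtain t where "t \<in> ball 0 \<epsilon>" "t \<notin> S" by blast
  then show ?thesis using that[of t] by simp
qed

theorem lemma4p2:
  fixes f :: "complex \<times> complex \<Rightarrow> complex"
  assumes "polynomial2 f"
    and "isolated_singularity f"
    and "fil (3, 1) f \<ge> 9"
  shows "deforms_to f J30"
proof -
  obtain N a where f: "\<And>x y. f (x, y) = (\<Sum>i\<le>N. \<Sum>j\<le>N. a i j * x ^ i * y ^ j)"
    using assms(1) unfolding polynomial2_def by blast
  have "wt constants fst snd 9 f"
    by (rule wt_of_fil[OF f]) (use assms(3) in \<open>simp add: numeral_eq_enat\<close>)
  then obtain k R where R: "wt constants fst snd 10 R"
    and k: "\<And>z. f z = (\<Sum>i\<le>9 div 3. k i * fst z ^ i * snd z ^ (9 - 3 * i)) + R z"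
    by (rule wt_leading_part) (simp add: that)
  have k: "f (x, y) = k 3 * x ^ 3 + k 2 * x ^ 2 * y ^ 3 + k 1 * x * y ^ 6 + k 0 * y ^ 9 + R (x, y)" for x y
  proof -
    have "{..9 div 3} = {0, 1, 2, 3 :: nat}" by auto
    then show ?thesis unfolding k by simp
  qed
  have "R (0, 0) = 0" 
    using R by induction (auto simp: power_0_left)
  then have f0: "f (0, 0) = 0" by (simp add: k)
  \<comment> \<open>\<open>t 0\<close> makes the coefficient of \<open>x ^ 3\<close> nonzero.
    \<open>t 1\<close> shifts the constant term of the cubic, which leaves its critical points
    fixed.\<close>
  define F where "F p t = f p + t 0 * fst p ^ 3 + t 1 * snd p ^ 9"
    for p :: "complex \<times> complex" and t :: "nat \<Rightarrow> complex"
  have "analytic_germ 4 (\<lambda>z. (\<Sum>i\<le>N. \<Sum>j\<le>N. a i j * z 0 ^ i * z 1 ^ j * z 2 ^ 0 * z 3 ^ 0)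
      + 1 * z 0 ^ 3 * z 1 ^ 0 * z 2 ^ 1 * z 3 ^ 0 + 1 * z 0 ^ 0 * z 1 ^ 9 * z 2 ^ 0 * z 3 ^ 1)"
    by (intro analytic_germ_add analytic_germ_sum analytic_germ_monomial4) auto
  moreover have index: "2 + 0 = (2 :: nat)" "2 + 1 = (3 :: nat)" by simp_all
  ultimately have "analytic_germ (2 + 2) (\<lambda>z. F (z 0, z 1) (\<lambda>i. z (2 + i)))"
    unfolding F_def index by (simp add: f mult_ac)
  then have def: "deformation 2 f F"
    unfolding deformation_def using f0 by (simp add: F_def zero_prod_def)
  have near: "\<exists>t\<in>tuples 2. t \<noteq> (\<lambda>_. 0) \<and> (\<forall>i<2. cmod (t i) < \<epsilon>) \<and>
      (\<exists>g\<in>J30. right_equivalent (\<lambda>p. F p t) g)" if \<epsilon>: "\<epsilon> > 0" for \<epsilon>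
  proof -
    \<comment> \<open>Avoiding 0 ensures a nonzero parameter, avoiding \<open>- k 3\<close> a
      nonzero leading coefficient \<open>a3\<close>.\<close>
    obtain t0 where t0: "cmod t0 < \<epsilon>" "t0 \<notin> {0, - k 3}"
      by (rule exists_small_avoiding[of "{0, - k 3}" \<epsilon>]) (use \<epsilon> in auto)
    define a3 where "a3 = k 3 + t0"
    have a3: "a3 \<noteq> 0" using t0(2) by (auto simp: a3_def add_eq_0_iff)
    \<comment> \<open>A zero of the derivative of the cubic, from the quadratic formula.\<close>
    define s where "s = (csqrt (k 2 ^ 2 - 3 * a3 * k 1) - k 2) / (3 * a3)"
    have "3 * a3 * s + k 2 = csqrt (k 2 ^ 2 - 3 * a3 * k 1)"
      using a3 by (simp add: s_def)
    then have "(3 * a3 * s + k 2) ^ 2 = k 2 ^ 2 - 3 * a3 * k 1"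
      by simp
    then have "(3 * a3) * (3 * a3 * s ^ 2 + 2 * k 2 * s + k 1) = 0" by algebra
    then have s: "3 * a3 * s ^ 2 + 2 * k 2 * s + k 1 = 0" using a3 by simp
    \<comment> \<open>\<open>D\<close> is the critical value for \<open>t1 = 0\<close>, and
      \<open>D + t1\<close> the perturbed one. \<open>D'\<close> is the value at which the remaining
      discriminant factor vanishes.\<close>
    define D where "D = a3 * s ^ 3 + k 2 * s ^ 2 + k 1 * s + k 0"
    define D' where "D' = - 4 * (3 * a3 * s + k 2) ^ 3 / (27 * a3 ^ 2)"
    obtain t1 where t1: "cmod t1 < \<epsilon>" "t1 \<notin> {- D, D' - D}"
      by (rule exists_small_avoiding[of "{- D, D' - D}" \<epsilon>]) (use \<epsilon> in auto)
    have D: "D + t1 \<noteq> 0" "D + t1 \<noteq> D'" using t1(2) by (auto simp: add_eq_0_iff)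
    have "27 * a3 ^ 2 * D' = - 4 * (3 * a3 * s + k 2) ^ 3" using a3 by (simp add: D'_def)
    then have "4 * (3 * a3 * s + k 2) ^ 3 + 27 * a3 ^ 2 * (D + t1) = 27 * a3 ^ 2 * ((D + t1) - D')"
      by algebra
    then have \<delta>: "4 * (3 * a3 * s + k 2) ^ 3 + 27 * a3 ^ 2 * (D + t1) \<noteq> 0" using D(2) a3 by simp
    define t where "t = (\<lambda>i :: nat. if i = 0 then t0 else if i = 1 then t1 else 0)"
    have "\<exists>g\<in>J30. right_equivalent (\<lambda>p. F p t) g"
    proof (rule right_equivalent_J30[OF R _ a3 s])
      show "F (x, y) t = a3 * x ^ 3 + k 2 * x ^ 2 * y ^ 3 + k 1 * x * y ^ 6 + (k 0 + t1) * y ^ 9 + R (x, y)" for x y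
        by (simp add: F_def t_def k a3_def algebra_simps)
    qed (use D(1) \<delta> in \<open>simp_all add: D_def add.assoc\<close>)
    moreover have "t \<in> tuples 2" "t \<noteq> (\<lambda>_. 0)" "\<forall>i<2. cmod (t i) < \<epsilon>"
      using t0 t1 \<epsilon> by (auto simp: t_def tuples_def fun_eq_iff)
    ultimately show ?thesis by blast
  qed
  show ?thesis
    unfolding deforms_to_def
    by (rule exI[of _ 2], rule exI[of _ F]) (simp add: def near)
qed

end
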